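(* Let $S=\langle n_1,n_2,n_3,n_4\rangle$ be a 4-generated pseudo-symmetric numerical semigroup with $n_1<n_2<n_3<n_4$, with associated integers $\alpha_1,\alpha_2,\alpha_3,\alpha_4,\alpha_{21}$, and suppose $\alpha_2>\alpha_{21}+1$. Then the local ring $R_S=K[[t^{n_1},t^{n_2},t^{n_3},t^{n_4}]]$ has non-decreasing Hilbert function, i.e. $H_{R_S}(n)\ge H_{R_S}(n-1)$ for all $n\geq 1$.
   Context: $K$ is an algebraically closed field. For positive integers $n_1<n_2<n_3<n_4$ with $\gcd=1$, $S=\langle n_1,\dots,n_4\rangle=\{\sum u_in_i: u_i\in\mathbb N\}$. $R_S$ has maximal ideal $\mathfrak m=\langle t^{n_1},\dots,t^{n_4}\rangle$, and its Hilbert function is $H_{R_S}(n)=\dim_{R_S/\mathfrak m}(\mathfrak m^n/\mathfrak m^{n+1})$, $n\ge0$. By Komeda, a 4-generated semigroup $S$ is pseudo-symmetric if and only if there are integers $\alpha_i>1$ ($1\le i\le 4$) and $\alpha_{21}$ with $0<\alpha_{21}<\alpha_1-1$ such that $n_1=\alpha_2\alpha_3(\alpha_4-1)+1$, $n_2=\alpha_{21}\alpha_3\alpha_4+(\alpha_1-\alpha_{21}-1)(\alpha_3-1)+\alpha_3$, $n_3=\alpha_1\alpha_4+(\alpha_1-\alpha_{21}-1)(\alpha_2-1)(\alpha_4-1)-\alpha_4+1$, $n_4=\alpha_1\alpha_2(\alpha_3-1)+\alpha_{21}(\alpha_2-1)+\alpha_2$. These are the integers used in the claim. *)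

theory Defs
  imports
    "HOL-Computational_Algebra.Formal_Power_Series"
    "HOL-Computational_Algebra.Polynomial"
    "HOL-Algebra.Ideal_Product"
    "HOL-Algebra.QuotRing"
    "Jordan_Normal_Form.Missing_VectorSpace"
begin

section \<open>Numerical semigroups\<close>

definition gen_semigroup :: "nat set \<Rightarrow> nat set" where
  "gen_semigroup G = {\<Sum>g\<in>G. u g * g | u :: nat \<Rightarrow> nat. True}"

definition minimal_generators :: "nat set \<Rightarrow> bool" where
  "minimal_generators G \<longleftrightarrow> (\<forall>g\<in>G. g \<notin> gen_semigroup (G - {g}))"

text \<open>The greatest integer (not natural number) outside \<open>S\<close>, so the value for \<open>S = \<nat>\<close> is \<open>-1\<close>.\<close>

definition frobenius_number :: "nat set \<Rightarrow> int" where
  "frobenius_number S = (GREATEST x::int. x \<notin> int ` S)"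

definition pseudo_symmetric :: "nat set \<Rightarrow> bool" where
  "pseudo_symmetric S \<longleftrightarrow>
     even (frobenius_number S) \<and>
     (\<forall>x::int. x \<notin> int ` S \<and> x \<noteq> frobenius_number S div 2
        \<longrightarrow> frobenius_number S - x \<in> int ` S)"


section \<open>The ring of formal power series in monomials of one variable\<close>

text \<open>
  The subring \<open>K[[t\<^sup>g : g \<in> G]]\<close> of \<open>K[[t]]\<close> is the image of the power series ring in variables
  \<open>x\<^sub>g\<close>, \<open>g \<in> G\<close>, under the substitution \<open>x\<^sub>g \<mapsto> t\<^sup>g\<close>: below, \<open>c u\<close> is the coefficient of the
  monomial with exponent vector \<open>u\<close>. The inner sum is finite when \<open>G\<close> is a finite set of positive
  numbers, which is the only case of interest.
\<close>

definition monomial_fps_ring :: "nat set \<Rightarrow> 'k::field fps ring" where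
  "monomial_fps_ring G =
     \<lparr>carrier = {f. \<exists>c :: (nat \<Rightarrow> nat) \<Rightarrow> 'k. \<forall>k.
                   fps_nth f k = (\<Sum>u | u \<in> G \<rightarrow>\<^sub>E UNIV \<and> (\<Sum>g\<in>G. u g * g) = k. c u)},
      mult = (*), one = 1, zero = 0, add = (+)\<rparr>"

definition monomial_ideal :: "nat set \<Rightarrow> 'k::field fps set" where
  "monomial_ideal G = Idl\<^bsub>monomial_fps_ring G\<^esub> ((\<lambda>g. fps_X ^ g) ` G)"


section \<open>The Hilbert function of a local ring\<close>

abbreviation ideal_power :: "('a, 'b) ring_scheme \<Rightarrow> 'a set \<Rightarrow> nat \<Rightarrow> 'a set" where
  "ideal_power R M n \<equiv> M [^]\<^bsub>ideals_set R\<^esub> n"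

text \<open>
  The \<open>R/M\<close>-module \<open>M\<^sup>n / M\<^sup>n\<^sup>+\<^sup>1\<close>. Scalar multiplication takes a coset \<open>M + a\<close> and a coset
  \<open>M\<^sup>n\<^sup>+\<^sup>1 + x\<close> with \<open>x \<in> M\<^sup>n\<close> to \<open>M\<^sup>n\<^sup>+\<^sup>1 + a x\<close>, which is the union that
  \<^const>\<open>rcoset_mult\<close> forms. The fields \<open>mult\<close> and \<open>one\<close> of the record play no role.
\<close>

definition graded_piece :: "('a, 'b) ring_scheme \<Rightarrow> 'a set \<Rightarrow> nat \<Rightarrow> ('a set, 'a set) module" where
  "graded_piece R M n = (let J = ideal_power R M (Suc n) in
     \<lparr>carrier = (\<lambda>x. J +>\<^bsub>R\<^esub> x) ` ideal_power R M n,
      mult = rcoset_mult R J, one = J +>\<^bsub>R\<^esub> \<one>\<^bsub>R\<^esub>,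
      zero = J, add = set_add R, smult = rcoset_mult R J\<rparr>)"

definition hilbert_function :: "('a, 'b) ring_scheme \<Rightarrow> 'a set \<Rightarrow> nat \<Rightarrow> nat" where
  "hilbert_function R M n = vectorspace.dim (R Quot M) (graded_piece R M n)"


section \<open>Well-definedness\<close>

text \<open>
  For a finite set \<open>G\<close> of positive numbers, \<^const>\<open>monomial_fps_ring\<close> consists of the power
  series supported on the semigroup generated by \<open>G\<close>, the ideal \<^const>\<open>monomial_ideal\<close> is a
  maximal ideal of it, and the graded pieces are vector spaces over the residue field, as
  \<^const>\<open>vectorspace.dim\<close> requires.
\<close>

lemma carrier_monomial_fps_ring:
  assumes "finite G" and "0 \<notin> G"
  shows "carrier (monomial_fps_ring G :: 'k::field fps ring) =
           {f. \<forall>k. fps_nth f k \<noteq> 0 \<longrightarrow> k \<in> gen_semigroup G}"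
proof (intro equalityI subsetI)
  fix f :: "'k fps"
  assume "f \<in> carrier (monomial_fps_ring G)"
  then obtain c :: "(nat \<Rightarrow> nat) \<Rightarrow> 'k" where c: "\<And>k. fps_nth f k =
      (\<Sum>u | u \<in> G \<rightarrow>\<^sub>E UNIV \<and> (\<Sum>g\<in>G. u g * g) = k. c u)"
    by (auto simp: monomial_fps_ring_def)
  have "k \<in> gen_semigroup G" if "fps_nth f k \<noteq> 0" for k
  proof -
    from that obtain u where "u \<in> {u \<in> G \<rightarrow>\<^sub>E UNIV. (\<Sum>g\<in>G. u g * g) = k}"
      unfolding c[of k] by (rule sum.not_neutral_contains_not_neutral)
    then show ?thesis by (auto simp: gen_semigroup_def)
  qed
  then show "f \<in> {f. \<forall>k. fps_nth f k \<noteq> 0 \<longrightarrow> k \<in> gen_semigroup G}" by blast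
next
  fix f :: "'k fps"
  assume "f \<in> {f. \<forall>k. fps_nth f k \<noteq> 0 \<longrightarrow> k \<in> gen_semigroup G}"
  then have f: "k \<in> gen_semigroup G" if "fps_nth f k \<noteq> 0" for k using that by blast
  let ?U = "\<lambda>k. {u. u \<in> G \<rightarrow>\<^sub>E UNIV \<and> (\<Sum>g\<in>G. u g * g) = k}"
  have fin: "finite (?U k)" for k
  proof (rule finite_subset)
    show "?U k \<subseteq> G \<rightarrow>\<^sub>E {..k}"
    proof
      fix u assume "u \<in> ?U k"
      then have u: "u \<in> G \<rightarrow>\<^sub>E UNIV" "(\<Sum>g\<in>G. u g * g) = k" by auto
      have "u g \<le> k" if "g \<in> G" for g
      proof -
        have "u g \<le> u g * g" using that assms(2) by (cases g) auto
        also have "\<dots> \<le> (\<Sum>g\<in>G. u g * g)" using that assms(1) by (intro member_le_sum) auto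
        finally show ?thesis using u by simp
      qed
      then show "u \<in> G \<rightarrow>\<^sub>E {..k}" using u(1) by (auto simp: PiE_iff)
    qed
    show "finite (G \<rightarrow>\<^sub>E {..k})" using assms(1) by (intro finite_PiE) auto
  qed
  have ne: "?U k \<noteq> {}" if "k \<in> gen_semigroup G" for k
  proof -
    from that obtain u where u: "k = (\<Sum>g\<in>G. u g * g)" by (auto simp: gen_semigroup_def)
    have "restrict u G \<in> ?U k" by (auto simp: u intro: sum.cong)
    then show ?thesis by blast
  qed
  define p where "p k = (SOME u. u \<in> ?U k)" for k
  have p: "p k \<in> ?U k" if "k \<in> gen_semigroup G" for k
    using ne[OF that] unfolding p_def some_in_eq .
  define c where "c u = (let k = (\<Sum>g\<in>G. u g * g) in if u = p k then fps_nth f k else 0)" for u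
  have "fps_nth f k = (\<Sum>u\<in>?U k. c u)" for k
  proof (cases "k \<in> gen_semigroup G")
    case True
    have "(\<Sum>u\<in>?U k. c u) = (\<Sum>u\<in>?U k. if u = p k then fps_nth f k else 0)"
      by (intro sum.cong) (auto simp: c_def Let_def)
    also have "\<dots> = fps_nth f k" using p[OF True] fin[of k] by (subst sum.delta) auto
    finally show ?thesis by simp
  next
    case False
    then have "fps_nth f k = 0" using f by blast
    moreover have "?U k = {}" using False by (auto simp: gen_semigroup_def)
    ultimately show ?thesis by (metis sum.empty)
  qed
  then show "f \<in> carrier (monomial_fps_ring G)" by (auto simp: monomial_fps_ring_def)
qed

lemma gen_semigroup_zero: "0 \<in> gen_semigroup G"
  by (auto simp: gen_semigroup_def intro!: exI[of _ "\<lambda>_. 0"])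

lemma gen_semigroup_add:
  assumes "a \<in> gen_semigroup G" "b \<in> gen_semigroup G"
  shows "a + b \<in> gen_semigroup G"
proof -
  from assms obtain u v where "a = (\<Sum>g\<in>G. u g * g)" "b = (\<Sum>g\<in>G. v g * g)"
    by (auto simp: gen_semigroup_def)
  then have "a + b = (\<Sum>g\<in>G. (u g + v g) * g)" by (simp add: sum.distrib algebra_simps)
  then show ?thesis by (auto simp: gen_semigroup_def intro!: exI[of _ "\<lambda>g. u g + v g"])
qed

lemma gen_semigroup_generator:
  assumes "finite G" "h \<in> G"
  shows "h \<in> gen_semigroup G"
proof -
  have "h = (\<Sum>g\<in>G. (if g = h then 1 else 0) * g)" using assms 
    by (simp add: if_distrib[of "\<lambda>x. x * _"] cong: if_cong)
  then show ?thesis unfolding gen_semigroup_def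
    by (intro CollectI exI[of _ "\<lambda>g. if g = h then 1 else 0"] conjI TrueI)
qed

lemma monomial_fps_ring_ops [simp]:
  "mult (monomial_fps_ring G) = (*)" "one (monomial_fps_ring G) = 1"
  "zero (monomial_fps_ring G) = 0" "add (monomial_fps_ring G) = (+)"
  by (simp_all add: monomial_fps_ring_def)

lemma cring_monomial_fps_ring:
  assumes "finite G" and "0 \<notin> G"
  shows "cring (monomial_fps_ring G :: 'k::field fps ring)"
proof -
  let ?R = "monomial_fps_ring G :: 'k fps ring"
  note C = carrier_monomial_fps_ring[OF assms, where 'k = 'k]
  have mult: "f * g \<in> carrier ?R" if "f \<in> carrier ?R" "g \<in> carrier ?R" for f g
  proof -
    have "k \<in> gen_semigroup G" if "fps_nth (f * g) k \<noteq> 0" for k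
    proof -
      from that have "(\<Sum>i=0..k. fps_nth f i * fps_nth g (k - i)) \<noteq> 0"
        by (simp add: fps_mult_nth)
      then obtain i where "i \<in> {0..k}" "fps_nth f i * fps_nth g (k - i) \<noteq> 0"
        by (rule sum.not_neutral_contains_not_neutral)
      then show ?thesis using \<open>f \<in> _\<close> \<open>g \<in> _\<close> gen_semigroup_add[of i G "k - i"] by (auto simp: C)
    qed
    then show ?thesis by (auto simp: C)
  qed
  have add: "f + g \<in> carrier ?R" if "f \<in> carrier ?R" "g \<in> carrier ?R" for f g
  proof -
    have "k \<in> gen_semigroup G" if "fps_nth (f + g) k \<noteq> 0" for k
      using that \<open>f \<in> _\<close> \<open>g \<in> _\<close> by (cases "fps_nth f k = 0") (simp_all add: C)
    then show ?thesis by (simp add: C)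
  qed
  have one: "1 \<in> carrier ?R" and zero: "0 \<in> carrier ?R"
    by (simp_all add: C gen_semigroup_zero)
  have neg: "- x \<in> carrier ?R" if "x \<in> carrier ?R" for x using that by (simp add: C)
  show ?thesis
  proof (rule cringI)
    show "abelian_group ?R"
    proof (rule abelian_groupI)
      fix x assume "x \<in> carrier ?R"
      then show "\<exists>y\<in>carrier ?R. y \<oplus>\<^bsub>?R\<^esub> x = \<zero>\<^bsub>?R\<^esub>"
        by (intro bexI[OF _ neg]) simp_all
    qed (simp_all add: add zero ac_simps)
    show "comm_monoid ?R"
      by (rule comm_monoidI) (simp_all add: mult one ac_simps)
  qed (simp add: distrib_right)
qed

lemma monomial_ideal_eq:
  assumes "finite G" and "0 \<notin> G"
  shows "monomial_ideal G = {f \<in> carrier (monomial_fps_ring G :: 'k::field fps ring). fps_nth f 0 = 0}"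
proof -
  let ?R = "monomial_fps_ring G :: 'k fps ring"
  note C = carrier_monomial_fps_ring[OF assms, where 'k = 'k]
  interpret cring ?R by (rule cring_monomial_fps_ring[OF assms])
  let ?I = "{f \<in> carrier ?R. fps_nth f 0 = 0}"
  have idl: "ideal ?I ?R"
  proof (rule idealI)
    show "subgroup ?I (add_monoid ?R)"
    proof
      fix x assume x: "x \<in> ?I"
      then have "\<ominus>\<^bsub>?R\<^esub> x = - x"
        by (intro minus_equality) (auto simp: C)
      then have "inv\<^bsub>add_monoid ?R\<^esub> x = - x" by (simp add: a_inv_def)
      then show "inv\<^bsub>add_monoid ?R\<^esub> x \<in> ?I" using x by (auto simp: C)
    qed (use a_closed zero_closed in \<open>auto simp: C\<close>)
  qed (use m_closed ring_axioms in auto)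
  have gens: "(\<lambda>g. fps_X ^ g) ` G \<subseteq> ?I"
  proof safe
    fix g assume g: "g \<in> G"
    show "fps_X ^ g \<in> carrier ?R" using gen_semigroup_generator[OF assms(1) g] by (auto simp: C fps_X_power_nth)
    show "fps_nth (fps_X ^ g) 0 = (0::'k)" using g assms(2) by (cases g) (auto simp: fps_X_power_nth)
  qed
  have sup: "f \<in> monomial_ideal G" if f: "f \<in> ?I" for f
  proof -
    have idl': "ideal (monomial_ideal G) ?R" unfolding monomial_ideal_def
      using gens by (intro genideal_ideal) auto
    interpret J: ideal "monomial_ideal G" ?R by (rule idl')
    have gen: "fps_X ^ g \<in> (monomial_ideal G :: 'k fps set)" if "g \<in> G" for g
    proof -
      have "(\<lambda>g. fps_X ^ g) ` G \<subseteq> (monomial_ideal G :: 'k fps set)"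
        unfolding monomial_ideal_def by (rule genideal_self) (use gens in auto)
      then show ?thesis using that by auto
    qed
    have ex: "\<exists>g\<in>G. k - g \<in> gen_semigroup G \<and> g \<le> k" if k: "k \<in> gen_semigroup G" "k \<noteq> 0" for k
    proof -
      from k obtain u where u: "k = (\<Sum>g\<in>G. u g * g)" by (auto simp: gen_semigroup_def)
      have "\<exists>g\<in>G. u g * g \<noteq> 0"
      proof (rule ccontr)
        assume "\<not> (\<exists>g\<in>G. u g * g \<noteq> 0)"
        then have "(\<Sum>g\<in>G. u g * g) = 0" by (intro sum.neutral) blast
        with u k(2) show False by simp
      qed
      then obtain g where g: "g \<in> G" "u g * g \<noteq> 0" by blast
      then obtain a where a: "u g = Suc a" by (cases "u g") auto
      have "k = u g * g + (\<Sum>h\<in>G-{g}. u h * h)" unfolding u using assms(1) g(1) by (rule sum.remove)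
      moreover have "(\<Sum>h\<in>G. (u(g := a)) h * h) = a * g + (\<Sum>h\<in>G-{g}. u h * h)"
        using g assms(1) by (subst sum.remove[of _ g]) (auto intro!: sum.cong)
      ultimately have "k - g = (\<Sum>h\<in>G. (u(g := a)) h * h)" "g \<le> k" using a by auto
      then show ?thesis using g unfolding gen_semigroup_def by blast
    qed
    define p where "p k = (SOME g. g \<in> G \<and> k - g \<in> gen_semigroup G \<and> g \<le> k)" for k
    have p: "p k \<in> G \<and> k - p k \<in> gen_semigroup G \<and> p k \<le> k"
      if "k \<in> gen_semigroup G" "k \<noteq> 0" for k
      unfolding p_def by (rule someI_ex) (use ex[OF that] in blast)
    define h where "h g = Abs_fps (\<lambda>j. if p (j + g) = g \<and> j \<in> gen_semigroup G then fps_nth f (j + g) else 0)" for g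
    have h: "h g \<in> carrier ?R" for g by (auto simp: C h_def)
    have f_eq: "f = (\<Sum>g\<in>G. fps_X ^ g * h g)"
    proof (rule fps_ext)
      fix k
      have f0: "fps_nth f 0 = 0" and fs: "fps_nth f k \<noteq> 0 \<Longrightarrow> k \<in> gen_semigroup G" using f by (auto simp: C)
      show "fps_nth f k = fps_nth (\<Sum>g\<in>G. fps_X ^ g * h g) k"
      proof (cases "fps_nth f k = 0")
        case True
        then have "fps_nth (fps_X ^ g * h g) k = 0" for g
          by (auto simp: fps_X_power_mult_nth h_def)
        then show ?thesis using True by (simp add: fps_sum_nth)
      next
        case False
        then have k: "k \<in> gen_semigroup G" "k \<noteq> 0" using fs f0 by (auto intro: Nat.gr0I)
        note pk = p[OF k]
        have "fps_nth (\<Sum>g\<in>G. fps_X ^ g * h g) k = (\<Sum>g\<in>G. if g = p k then fps_nth f k else 0)"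
          unfolding fps_sum_nth
        proof (intro sum.cong refl)
          fix g
          show "fps_nth (fps_X ^ g * h g) k = (if g = p k then fps_nth f k else 0)"
            using pk by (cases "g \<le> k") (auto simp: fps_X_power_mult_nth h_def)
        qed
        then show ?thesis using pk assms(1) by simp
      qed
    qed
    have mem: "(\<Sum>g\<in>A. fps_X ^ g * h g) \<in> monomial_ideal G" if "A \<subseteq> G" for A
      using finite_subset[OF that assms(1)] that
    proof (induction A rule: finite_induct)
      case empty
      then show ?case using J.zero_closed by simp
    next
      case (insert x F)
      have "fps_X ^ x * h x \<in> monomial_ideal G"
        using J.I_r_closed[OF gen h] insert by auto
      then show ?case using insert J.a_closed by auto
    qed
    note f_eq
    also note mem[OF order_refl]
    finally show ?thesis .
  qed
  have sub: "monomial_ideal G \<subseteq> ?I"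
    unfolding monomial_ideal_def using genideal_minimal[OF idl gens] .
  show ?thesis by (rule equalityI[OF sub]) (rule subsetI, rule sup)
qed

lemma ideal_ideal_power:
  assumes "cring R" "ideal M R"
  shows "ideal (ideal_power R M n) R"
proof -
  interpret cring R by fact
  interpret I: comm_monoid "ideals_set R" by (rule ideals_set_is_comm_monoid)
  have "M [^]\<^bsub>ideals_set R\<^esub> n \<in> carrier (ideals_set R)"
    by (rule I.nat_pow_closed) (use assms in \<open>simp add: ideals_set_def\<close>)
  then show ?thesis by (simp add: ideals_set_def)
qed

lemma ideal_power_Suc: "ideal_power R M (Suc n) = ideal_power R M n \<cdot>\<^bsub>R\<^esub> M"
  by (simp add: ideals_set_def)

lemma rcoset_mult_graded:
  assumes "cring R" "ideal M R" "a \<in> carrier R" "x \<in> ideal_power R M n"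
  defines "J \<equiv> ideal_power R M (Suc n)"
  shows "rcoset_mult R J (M +>\<^bsub>R\<^esub> a) (J +>\<^bsub>R\<^esub> x) = J +>\<^bsub>R\<^esub> (a \<otimes>\<^bsub>R\<^esub> x)"
proof -
  interpret cring R by fact
  interpret M: ideal M R by fact
  interpret I: ideal "ideal_power R M n" R by (rule ideal_ideal_power) fact+
  interpret J: ideal J R unfolding J_def by (rule ideal_ideal_power) fact+
  have xc: "x \<in> carrier R" using assms by simp
  have 1: "J +>\<^bsub>R\<^esub> (b \<otimes>\<^bsub>R\<^esub> y) = J +>\<^bsub>R\<^esub> (a \<otimes>\<^bsub>R\<^esub> x)"
    if "b \<in> M +>\<^bsub>R\<^esub> a" "y \<in> J +>\<^bsub>R\<^esub> x" for b y
  proof -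
    from that obtain m j where m: "m \<in> M" "b = m \<oplus>\<^bsub>R\<^esub> a" and j: "j \<in> J" "y = j \<oplus>\<^bsub>R\<^esub> x"
      by (auto simp: a_r_coset_def r_coset_def)
    have [simp]: "m \<in> carrier R" "j \<in> carrier R" using m j by auto
    have "x \<otimes>\<^bsub>R\<^esub> m \<in> J" unfolding J_def ideal_power_Suc
      using ideal_prod.prod assms(4) m(1) by fast
    then have mx: "m \<otimes>\<^bsub>R\<^esub> x \<in> J" using m_comm[of m x] xc by simp
    have "m \<otimes>\<^bsub>R\<^esub> x \<oplus>\<^bsub>R\<^esub> (m \<oplus>\<^bsub>R\<^esub> a) \<otimes>\<^bsub>R\<^esub> j \<in> J" 
      using mx j(1) assms(3) \<open>m \<in> carrier R\<close> by (simp add: J.I_l_closed)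
    moreover have "b \<otimes>\<^bsub>R\<^esub> y = (m \<otimes>\<^bsub>R\<^esub> x \<oplus>\<^bsub>R\<^esub> (m \<oplus>\<^bsub>R\<^esub> a) \<otimes>\<^bsub>R\<^esub> j) \<oplus>\<^bsub>R\<^esub> (a \<otimes>\<^bsub>R\<^esub> x)"
      unfolding m j using xc assms(3) \<open>m \<in> carrier R\<close> \<open>j \<in> carrier R\<close> by algebra
    ultimately have "b \<otimes>\<^bsub>R\<^esub> y \<in> J +>\<^bsub>R\<^esub> (a \<otimes>\<^bsub>R\<^esub> x)"
      by (auto simp: a_r_coset_def r_coset_def)
    then show ?thesis using xc assms(3) J.a_repr_independence' by (metis m_closed)
  qed
  moreover have "a \<in> M +>\<^bsub>R\<^esub> a" "x \<in> J +>\<^bsub>R\<^esub> x"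
    using M.a_rcos_self J.a_rcos_self assms(3) xc by auto
  ultimately show ?thesis unfolding rcoset_mult_def by blast
qed

lemma vectorspace_graded_piece:
  assumes "cring R" "maximalideal M R"
  shows "vectorspace (R Quot M) (graded_piece R M n)"
proof -
  interpret cring R by fact
  interpret M: maximalideal M R by fact
  define J where "J = ideal_power R M (Suc n)"
  define I where "I = ideal_power R M n"
  interpret I: ideal I R unfolding I_def by (rule ideal_ideal_power) (fact, rule M.is_ideal)
  interpret J: ideal J R unfolding J_def by (rule ideal_ideal_power) (fact, rule M.is_ideal)
  interpret Q: field "R Quot M" by (rule M.quotient_is_field) fact
  let ?V = "graded_piece R M n"
  have V: "carrier ?V = (\<lambda>x. J +>\<^bsub>R\<^esub> x) ` I" "add ?V = set_add R" "zero ?V = J" "smult ?V = rcoset_mult R J"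
    by (simp_all add: graded_piece_def J_def I_def Let_def)
  have Q: "carrier (R Quot M) = (\<lambda>x. M +>\<^bsub>R\<^esub> x) ` carrier R" "add (R Quot M) = set_add R"
     "mult (R Quot M) = rcoset_mult R M" "one (R Quot M) = M +>\<^bsub>R\<^esub> \<one>\<^bsub>R\<^esub>"
    by (auto simp: FactRing_def A_RCOSETS_def RCOSETS_def a_r_coset_def)
  have sm: "rcoset_mult R J (M +>\<^bsub>R\<^esub> a) (J +>\<^bsub>R\<^esub> x) = J +>\<^bsub>R\<^esub> (a \<otimes>\<^bsub>R\<^esub> x)"
    if "a \<in> carrier R" "x \<in> I" for a x
    using rcoset_mult_graded[of R M a x n] that assms M.is_ideal by (simp add: J_def I_def)
  have zero: "J = J +>\<^bsub>R\<^esub> \<zero>\<^bsub>R\<^esub>" using J.a_subset by simp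
  have ag: "abelian_group ?V"
  proof (rule abelian_groupI)
    fix x assume "x \<in> carrier ?V"
    then obtain a where a: "a \<in> I" "x = J +>\<^bsub>R\<^esub> a" by (auto simp: V)
    have "\<ominus>\<^bsub>R\<^esub> a \<in> I" using a by simp
    moreover have "(J +>\<^bsub>R\<^esub> \<ominus>\<^bsub>R\<^esub> a) <+>\<^bsub>R\<^esub> (J +>\<^bsub>R\<^esub> a) = J"
      using a J.a_subset by (simp add: J.a_rcos_sum l_neg)
    ultimately show "\<exists>y\<in>carrier ?V. y \<oplus>\<^bsub>?V\<^esub> x = \<zero>\<^bsub>?V\<^esub>" unfolding V a(2) by blast
  next
    show "\<zero>\<^bsub>?V\<^esub> \<in> carrier ?V" unfolding V using zero I.zero_closed by blast
    fix x assume "x \<in> carrier ?V"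
    then obtain a where a: "a \<in> I" "x = J +>\<^bsub>R\<^esub> a" by (auto simp: V)
    have "(J +>\<^bsub>R\<^esub> \<zero>\<^bsub>R\<^esub>) <+>\<^bsub>R\<^esub> (J +>\<^bsub>R\<^esub> a) = J +>\<^bsub>R\<^esub> a"
      using a by (subst J.a_rcos_sum) auto
    then show "\<zero>\<^bsub>?V\<^esub> \<oplus>\<^bsub>?V\<^esub> x = x" using a zero by (simp add: V)
  qed (auto simp: V J.a_rcos_sum a_assoc, auto simp: a_comm)
  show ?thesis
  proof (intro vectorspace.intro moduleI ag)
    show "cring (R Quot M)" by (rule Q.is_cring)
    show "field (R Quot M)" by (rule Q.field_axioms)
  qed (auto simp: V Q sm J.a_rcos_sum M.a_rcos_sum M.rcoset_mult_add I.I_l_closed l_distr r_distr m_assoc)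
qed

lemma maximalideal_monomial_ideal:
  assumes "finite G" and "0 \<notin> G"
  shows "maximalideal (monomial_ideal G) (monomial_fps_ring G :: 'k::field fps ring)"
proof -
  let ?R = "monomial_fps_ring G :: 'k fps ring"
  let ?M = "monomial_ideal G :: 'k fps set"
  note C = carrier_monomial_fps_ring[OF assms, where 'k = 'k]
  note M = monomial_ideal_eq[OF assms, where 'k = 'k]
  interpret cring ?R by (rule cring_monomial_fps_ring[OF assms])
  have const: "fps_const c \<in> carrier ?R" for c by (auto simp: C gen_semigroup_zero)
  show ?thesis
  proof (rule maximalidealI)
    show "ideal ?M ?R" unfolding monomial_ideal_def
    proof (rule genideal_ideal, safe)
      fix g assume g: "g \<in> G"
      show "fps_X ^ g \<in> carrier ?R"
        using gen_semigroup_generator[OF assms(1) g] by (auto simp: C fps_X_power_nth)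
    qed
    have "1 \<in> carrier ?R" "1 \<notin> ?M" using one_closed by (auto simp: M)
    then show "carrier ?R \<noteq> ?M" by blast
  next
    fix J assume J: "ideal J ?R" "?M \<subseteq> J" "J \<subseteq> carrier ?R"
    interpret J: ideal J ?R by fact
    show "J = ?M \<or> J = carrier ?R"
    proof (cases "J \<subseteq> ?M")
      case False
      then obtain f where f: "f \<in> J" "fps_nth f 0 \<noteq> 0" using J(3) by (auto simp: M)
      let ?c = "fps_nth f 0"
      have "fps_const ?c - f \<in> carrier ?R" using f J(3) by (auto simp: C gen_semigroup_zero split: if_splits)
      then have "fps_const ?c - f \<in> J" using J(2) by (auto simp: M)
      then have "fps_const ?c \<in> J" using J.a_closed[OF _ f(1)] by fastforce
      then have "fps_const (inverse ?c) * fps_const ?c \<in> J" using J.I_l_closed[OF _ const] by (auto simp del: fps_const_mult)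
      then have "1 \<in> J" using f(2) by simp
      then show ?thesis using J.one_imp_carrier by simp
    qed (use J in blast)
  qed
qed

end

theory Submission
  imports Defs
begin

text \<open>
  The Hilbert function is a count: \<open>H(n)\<close> is the number of semigroup elements whose longest
  factorization into generators has length \<open>n\<close> (\<open>hilbert_function_monomial_fps_ring\<close>). If the
  tangent cone were Cohen-Macaulay, adding \<open>n\<^sub>1\<close> would always lengthen the longest factorization
  by exactly one and so give an injection from the elements counted by \<open>H(n - 1)\<close> to those counted
  by \<open>H(n)\<close>. For \<open>\<alpha>\<^sub>2 > \<alpha>\<^sub>2\<^sub>1 + 1\<close> this fails: the relation
  \<open>X\<^sub>1\<^bsup>\<alpha>\<^sub>2\<^sub>1\<^esup> X\<^sub>4 = X\<^sub>2\<^bsup>\<alpha>\<^sub>2\<^esup>\<close> makes the length jump. The injection has to be corrected at the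
  jumps.

  To see where they are, one works with the leading monomials of the binomial relations among the
  generators, where the shorter side leads. Besides Komeda's five binomials there are
  two derived families, \<open>rel6\<close> and \<open>rel7\<close>. The monomials divisible by no leading monomial
  are normal forms: every element has one, it is a longest factorization
  (\<open>normal_form_exists\<close>), and it is unique (\<open>normal_form_unique\<close>). Uniqueness rests on the formula
  for \<open>n\<^sub>1\<close>, which says that an obvious set of representatives of the residue classes modulo
  \<open>n\<^sub>1\<close> has no more than \<open>n\<^sub>1\<close> elements.

  So \<open>H(n)\<close> is the number of normal monomials of degree \<open>n\<close>. Multiplication by \<open>X\<^sub>1\<close> leaves the
  set of normal monomials only at the boundaries given by \<open>X\<^sub>1\<^bsup>\<alpha>\<^sub>2\<^sub>1\<^esup> X\<^sub>4\<close> and by the right sides of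
  \<open>rel7\<close>. The monomials there are sent to normal monomials without \<open>X\<^sub>1\<close> instead
  (\<open>shift\<close>). There is room for both kinds: lowering the exponent of \<open>X\<^sub>4\<close> by one
  raises the bound on the exponent of \<open>X\<^sub>2\<close> by at least \<open>\<alpha>\<^sub>2\<close>. Images of the first kind gain
  only \<open>\<alpha>\<^sub>2\<^sub>1 + 1 < \<alpha>\<^sub>2\<close> there, and those of the second kind lie in the gap that this leaves or
  above it.
\<close>

section \<open>The Hilbert function counts semigroup elements\<close>

definition sums_of_length :: "nat set \<Rightarrow> nat \<Rightarrow> nat set" where
  "sums_of_length G n = {\<Sum>g\<in>G. u g * g | u :: nat \<Rightarrow> nat. n \<le> (\<Sum>g\<in>G. u g)}"

lemma sums_of_length_0: "sums_of_length G 0 = gen_semigroup G"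
  by (simp add: sums_of_length_def gen_semigroup_def)

lemma sums_of_length_add:
  assumes "a \<in> sums_of_length G m" "b \<in> sums_of_length G n"
  shows "a + b \<in> sums_of_length G (m + n)"
proof -
  from assms obtain u v where "a = (\<Sum>g\<in>G. u g * g)" "m \<le> (\<Sum>g\<in>G. u g)"
      "b = (\<Sum>g\<in>G. v g * g)" "n \<le> (\<Sum>g\<in>G. v g)"
    by (auto simp: sums_of_length_def)
  then show ?thesis
    unfolding sums_of_length_def
    by (intro CollectI exI[of _ "\<lambda>g. u g + v g"]) (auto simp: sum.distrib algebra_simps)
qed

lemma sums_of_length_Suc_diff:
  assumes "finite G" "s \<in> sums_of_length G (Suc n)"
  shows "\<exists>g\<in>G. g \<le> s \<and> s - g \<in> sums_of_length G n"
proof -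
  from assms obtain u where s: "s = (\<Sum>g\<in>G. u g * g)" and len: "Suc n \<le> (\<Sum>g\<in>G. u g)"
    by (auto simp: sums_of_length_def)
  have "\<exists>g\<in>G. u g \<noteq> 0"
  proof (rule ccontr)
    assume "\<not> ?thesis"
    then have "(\<Sum>g\<in>G. u g) = 0" by simp
    with len show False by simp
  qed
  then obtain g where g: "g \<in> G" "u g \<noteq> 0" by blast
  then obtain a where a: "u g = Suc a" by (cases "u g") auto
  let ?v = "u(g := a)"
  have "(\<Sum>h\<in>G - {g}. ?v h * h) = (\<Sum>h\<in>G - {g}. u h * h)" "(\<Sum>h\<in>G - {g}. ?v h) = (\<Sum>h\<in>G - {g}. u h)"
    by (intro sum.cong; simp)+
  then have 1: "s = g + (\<Sum>h\<in>G. ?v h * h)" and 2: "(\<Sum>h\<in>G. u h) = Suc (\<Sum>h\<in>G. ?v h)"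
    using assms(1) g(1) a by (simp_all add: s sum.remove[of _ g])
  from 2 len have "n \<le> (\<Sum>h\<in>G. ?v h)" by simp
  then have "s - g \<in> sums_of_length G n"
    using 1 unfolding sums_of_length_def by (intro CollectI exI[of _ ?v]) simp
  with g(1) 1 show ?thesis by (intro bexI[of _ g]) auto
qed

lemma finite_sums_of_length_diff:
  assumes "finite G"
  shows "finite (sums_of_length G n - sums_of_length G (Suc n))"
proof (rule finite_subset)
  show "sums_of_length G n - sums_of_length G (Suc n) \<subseteq> {..n * (\<Sum>g\<in>G. g)}"
  proof
    fix s assume "s \<in> sums_of_length G n - sums_of_length G (Suc n)"
    then obtain u where s: "s = (\<Sum>g\<in>G. u g * g)" and "\<not> Suc n \<le> (\<Sum>g\<in>G. u g)"
      by (auto simp: sums_of_length_def)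
    then have "(\<Sum>g\<in>G. u g) \<le> n" by simp
    then have "u g \<le> n" if "g \<in> G" for g
      using member_le_sum[OF that, of u] assms by simp
    then show "s \<in> {..n * (\<Sum>g\<in>G. g)}"
      by (auto simp: s sum_distrib_left intro!: sum_mono)
  qed
qed simp

text \<open>
  Powers of the maximal ideal are spanned by the monomials they contain: a monomial of exponent
  \<open>s\<close> lies in the \<open>n\<close>-th power exactly if \<open>s\<close> has a factorization into at least \<open>n\<close>
  generators. For power series, infinitely many exponents have to be distributed over the finitely
  many generators; this is possible because one generator is split off each exponent.
\<close>

lemma ideal_power_monomial_ideal:
  assumes "finite G" and "0 \<notin> G"
  shows "ideal_power (monomial_fps_ring G :: 'k::field fps ring) (monomial_ideal G) n =
           {f. \<forall>k. fps_nth f k \<noteq> 0 \<longrightarrow> k \<in> sums_of_length G n}"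
proof (induction n)
  case 0
  then show ?case
    by (simp add: ideals_set_def sums_of_length_0 carrier_monomial_fps_ring[OF assms])
next
  case (Suc n)
  let ?R = "monomial_fps_ring G :: 'k fps ring"
  let ?M = "monomial_ideal G :: 'k fps set"
  let ?P = "\<lambda>n. {f :: 'k fps. \<forall>k. fps_nth f k \<noteq> 0 \<longrightarrow> k \<in> sums_of_length G n}"
  have M: "f \<in> ?M \<Longrightarrow> fps_nth f k \<noteq> 0 \<Longrightarrow> k \<in> sums_of_length G 1" for f k
  proof -
    assume f: "f \<in> ?M" "fps_nth f k \<noteq> 0"
    then have "k \<in> gen_semigroup G" "k \<noteq> 0"
      by (auto simp: monomial_ideal_eq[OF assms] carrier_monomial_fps_ring[OF assms] intro: Nat.gr0I)
    then obtain u where u: "k = (\<Sum>g\<in>G. u g * g)" by (auto simp: gen_semigroup_def)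
    have "(\<Sum>g\<in>G. u g) \<noteq> 0"
    proof
      assume "(\<Sum>g\<in>G. u g) = 0"
      then have "k = 0" using assms(1) by (simp add: u)
      with \<open>k \<noteq> 0\<close> show False ..
    qed
    then have "1 \<le> (\<Sum>g\<in>G. u g)" by simp
    with u show "k \<in> sums_of_length G 1"
      unfolding sums_of_length_def by blast
  qed
  have "?P n \<cdot>\<^bsub>?R\<^esub> ?M = ?P (Suc n)"
  proof (intro equalityI subsetI)
    fix f assume "f \<in> ?P n \<cdot>\<^bsub>?R\<^esub> ?M"
    then show "f \<in> ?P (Suc n)"
    proof (induction rule: ideal_prod.induct)
      case (prod i j)
      have "k \<in> sums_of_length G (Suc n)" if "fps_nth (i * j) k \<noteq> 0" for k
      proof -
        from that have "(\<Sum>l=0..k. fps_nth i l * fps_nth j (k - l)) \<noteq> 0"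
          by (simp add: fps_mult_nth)
        then obtain l where l: "l \<in> {0..k}" "fps_nth i l * fps_nth j (k - l) \<noteq> 0"
          by (rule sum.not_neutral_contains_not_neutral)
        then have "l \<in> sums_of_length G n" "k - l \<in> sums_of_length G 1"
          using prod M by auto
        from sums_of_length_add[OF this] l show ?thesis by simp
      qed
      then show ?case by simp
    next
      case (sum s1 s2)
      have "k \<in> sums_of_length G (Suc n)" if "fps_nth (s1 + s2) k \<noteq> 0" for k
        using that sum.IH by (cases "fps_nth s1 k = 0") auto
      then show ?case by simp
    qed
  next
    fix f assume f: "f \<in> ?P (Suc n)"
    \<comment> \<open>\<open>h g\<close> collects the terms of \<open>f\<close> from whose exponent the generator \<open>g\<close> is split off.\<close>
    define p where "p k = (SOME g. g \<in> G \<and> g \<le> k \<and> k - g \<in> sums_of_length G n)" for k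
    have p: "p k \<in> G \<and> p k \<le> k \<and> k - p k \<in> sums_of_length G n" if "fps_nth f k \<noteq> 0" for k
      unfolding p_def by (rule someI_ex) (use f that sums_of_length_Suc_diff[OF assms(1)] in blast)
    define h where "h g = Abs_fps (\<lambda>j. if p (j + g) = g then fps_nth f (j + g) else 0)" for g
    have h: "h g \<in> ?P n" for g
    proof -
      have "j \<in> sums_of_length G n" if "fps_nth (h g) j \<noteq> 0" for j
        using that p[of "j + g"] by (auto simp: h_def split: if_splits)
      then show ?thesis by simp
    qed
    have f_eq: "f = (\<Sum>g\<in>G. h g * fps_X ^ g)"
    proof (rule fps_ext)
      fix k
      have "fps_nth (h g * fps_X ^ g) k = (if g = p k then fps_nth f k else 0)" for g
        using p[of k] by (cases "fps_nth f k = 0") (auto simp: h_def fps_X_power_mult_right_nth)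
      then have "fps_nth (\<Sum>g\<in>G. h g * fps_X ^ g) k = (\<Sum>g\<in>G. if g = p k then fps_nth f k else 0)"
        by (simp add: fps_sum_nth)
      also have "\<dots> = fps_nth f k"
        using p[of k] assms(1) by (cases "fps_nth f k = 0") simp_all
      finally show "fps_nth f k = fps_nth (\<Sum>g\<in>G. h g * fps_X ^ g) k" ..
    qed
    have X: "fps_X ^ g \<in> ?M" if "g \<in> G" for g
      using that gen_semigroup_generator[OF assms(1) that] assms(2)
      by (cases g) (auto simp: monomial_ideal_eq[OF assms] carrier_monomial_fps_ring[OF assms] fps_X_power_nth
            simp del: power_Suc)
    have zero: "0 \<in> ?P n \<cdot>\<^bsub>?R\<^esub> ?M"
      using ideal_prod.prod[of 0 "?P n" 0 ?M ?R]
      by (simp add: monomial_ideal_eq[OF assms] carrier_monomial_fps_ring[OF assms])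
    have "(\<Sum>g\<in>A. h g * fps_X ^ g) \<in> ?P n \<cdot>\<^bsub>?R\<^esub> ?M" if "A \<subseteq> G" for A
      using finite_subset[OF that assms(1)] that
    proof (induction A rule: finite_induct)
      case (insert x F)
      have "h x * fps_X ^ x \<in> ?P n \<cdot>\<^bsub>?R\<^esub> ?M"
        using ideal_prod.prod[of "h x" "?P n" "fps_X ^ x" ?M ?R] h X insert by simp
      then show ?case
        using ideal_prod.sum[of "h x * fps_X ^ x" ?R "?P n" ?M] insert by simp
    qed (simp add: zero)
    then show "f \<in> ?P n \<cdot>\<^bsub>?R\<^esub> ?M" by (subst f_eq) simp
  qed
  then show ?case unfolding ideal_power_Suc Suc.IH .
qed

text \<open>
  The cosets of the monomials \<open>t\<^sup>s\<close> form a basis of the graded piece, where \<open>s\<close> ranges over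
  the exponents that enter the \<open>n\<close>-th power but not the next one, that is, over those whose
  longest factorization has length \<open>n\<close>. Coefficients in the
  residue field may be taken to be constants, one in each residue class.
\<close>

theorem hilbert_function_monomial_fps_ring:
  assumes "finite G" and "0 \<notin> G"
  shows "hilbert_function (monomial_fps_ring G :: 'k::field fps ring) (monomial_ideal G) n =
           card (sums_of_length G n - sums_of_length G (Suc n))"
proof -
  define R where "R = (monomial_fps_ring G :: 'k fps ring)"
  define M where "M = (monomial_ideal G :: 'k fps set)"
  define I where "I = ideal_power R M n"
  define J where "J = ideal_power R M (Suc n)"
  define V where "V = graded_piece R M n"
  define L where "L = sums_of_length G n - sums_of_length G (Suc n)"
  define \<phi> where "\<phi> s = J +>\<^bsub>R\<^esub> (fps_X ^ s)" for s
  interpret S: cring R unfolding R_def by (rule cring_monomial_fps_ring[OF assms])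
  have maximal: "maximalideal M R"
    unfolding R_def M_def by (rule maximalideal_monomial_ideal[OF assms])
  interpret max: maximalideal M R by (rule maximal)
  interpret vectorspace "R Quot M" V
    unfolding V_def by (rule vectorspace_graded_piece[OF S.is_cring maximal])
  interpret J: ideal J R
    unfolding J_def by (rule ideal_ideal_power[OF S.is_cring max.is_ideal])
  interpret I: ideal I R
    unfolding I_def by (rule ideal_ideal_power[OF S.is_cring max.is_ideal])
  have ops: "add R = (+)" "zero R = 0" "mult R = (*)" "one R = 1" by (simp_all add: R_def)
  have C: "carrier R = {f. \<forall>k. fps_nth f k \<noteq> 0 \<longrightarrow> k \<in> gen_semigroup G}"
    unfolding R_def by (rule carrier_monomial_fps_ring[OF assms])
  have I: "I = {f. \<forall>k. fps_nth f k \<noteq> 0 \<longrightarrow> k \<in> sums_of_length G n}"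
    unfolding I_def R_def M_def by (rule ideal_power_monomial_ideal[OF assms])
  have J: "J = {f. \<forall>k. fps_nth f k \<noteq> 0 \<longrightarrow> k \<in> sums_of_length G (Suc n)}"
    unfolding J_def R_def M_def by (rule ideal_power_monomial_ideal[OF assms])
  have M: "M = {f \<in> carrier R. fps_nth f 0 = 0}"
    unfolding R_def M_def by (rule monomial_ideal_eq[OF assms])
  have V: "carrier V = (\<lambda>x. J +>\<^bsub>R\<^esub> x) ` I" "add V = set_add R" "zero V = J" "smult V = rcoset_mult R J"
    by (simp_all add: V_def graded_piece_def J_def I_def Let_def)
  have Q: "carrier (R Quot M) = (\<lambda>x. M +>\<^bsub>R\<^esub> x) ` carrier R" "zero (R Quot M) = M"
    by (auto simp: FactRing_def A_RCOSETS_def RCOSETS_def a_r_coset_def)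
  have L: "finite L" unfolding L_def by (rule finite_sums_of_length_diff[OF assms(1)])
  have coset_eq: "J +>\<^bsub>R\<^esub> f = J +>\<^bsub>R\<^esub> g \<longleftrightarrow> f - g \<in> J" if "f \<in> I" "g \<in> I" for f g
  proof
    have "f \<in> J +>\<^bsub>R\<^esub> f"
      using that(1) I.a_subset by (intro J.a_rcos_self) auto
    also assume "J +>\<^bsub>R\<^esub> f = J +>\<^bsub>R\<^esub> g"
    finally obtain j where "j \<in> J" "f = j + g" by (auto simp: a_r_coset_def r_coset_def ops)
    then show "f - g \<in> J" by simp
  next
    assume "f - g \<in> J"
    then have "f \<in> J +>\<^bsub>R\<^esub> g" by (force simp: a_r_coset_def r_coset_def ops)
    then show "J +>\<^bsub>R\<^esub> f = J +>\<^bsub>R\<^esub> g"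
      using that(2) I.a_subset by (intro J.a_repr_independence'[symmetric]) auto
  qed
  have const: "fps_const c \<in> carrier R" for c by (auto simp: C gen_semigroup_zero)
  have mono: "fps_X ^ s \<in> I" "fps_const c * fps_X ^ s \<in> I" if "s \<in> L" for s c
    using that by (auto simp: I L_def fps_X_power_nth fps_X_power_mult_right_nth split: if_splits)
  have inj: "inj_on \<phi> L"
  proof (rule inj_onI)
    fix s t assume st: "s \<in> L" "t \<in> L" "\<phi> s = \<phi> t"
    show "s = t"
    proof (rule ccontr)
      assume "s \<noteq> t"
      then have "fps_nth (fps_X ^ s - fps_X ^ t :: 'k fps) s \<noteq> 0" by (simp add: fps_X_power_nth)
      moreover have "fps_X ^ s - fps_X ^ t \<in> J" using st coset_eq mono unfolding \<phi>_def by blast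
      ultimately show False using st(1) by (auto simp: J L_def)
    qed
  qed
  have nth: "fps_nth (\<Sum>s\<in>F. fps_const (c s) * fps_X ^ s) t = (if t \<in> F then c t else 0)"
    if "F \<subseteq> L" for F t and c :: "nat \<Rightarrow> 'k"
    using finite_subset[OF that L] by (simp add: fps_sum_nth fps_X_power_nth if_distrib[of "\<lambda>x. _ * x"] cong: if_cong)
  have sum_I: "(\<Sum>s\<in>F. fps_const (c s) * fps_X ^ s) \<in> I" if "F \<subseteq> L" for F and c :: "nat \<Rightarrow> 'k"
    using that by (auto simp: I nth[OF that] L_def split: if_splits)
  have lincomb: "lincomb a (\<phi> ` L) = J +>\<^bsub>R\<^esub> (\<Sum>s\<in>L. fps_const (c s) * fps_X ^ s)"
    if a: "\<And>s. s \<in> L \<Longrightarrow> a (\<phi> s) = M +>\<^bsub>R\<^esub> fps_const (c s)" for a c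
  proof -
    have "lincomb a (\<phi> ` F) = J +>\<^bsub>R\<^esub> (\<Sum>s\<in>F. fps_const (c s) * fps_X ^ s)" if "F \<subseteq> L" for F
      using finite_subset[OF that L] that
    proof (induction F rule: finite_induct)
      case empty
      show ?case by (simp add: lincomb_def V S.a_coset_add_zero[OF J.a_subset, unfolded ops])
    next
      case (insert s F)
      have smult: "a (\<phi> t) \<odot>\<^bsub>V\<^esub> \<phi> t = J +>\<^bsub>R\<^esub> (fps_const (c t) * fps_X ^ t)" if "t \<in> L" for t
        using rcoset_mult_graded[OF S.is_cring max.is_ideal const mono(1)[OF that, unfolded I_def], of "c t"] a[OF that]
        by (simp add: V \<phi>_def J_def ops)
      have closed: "a (\<phi> t) \<odot>\<^bsub>V\<^esub> \<phi> t \<in> carrier V" if "t \<in> L" for t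
        unfolding smult[OF that] V(1) using mono(2)[OF that] by blast
      have "\<phi> s \<notin> \<phi> ` F" using insert inj by (auto dest: inj_onD)
      then have "lincomb a (\<phi> ` insert s F) = a (\<phi> s) \<odot>\<^bsub>V\<^esub> \<phi> s \<oplus>\<^bsub>V\<^esub> lincomb a (\<phi> ` F)"
        using insert closed unfolding lincomb_def image_insert by (intro finsum_insert) auto
      also have "\<dots> = J +>\<^bsub>R\<^esub> (fps_const (c s) * fps_X ^ s + (\<Sum>s\<in>F. fps_const (c s) * fps_X ^ s))"
        using insert smult[of s] mono(2)[of s "c s"] sum_I[of F c] I.a_subset
        by (simp add: V J.a_rcos_sum subset_iff) (simp add: ops)
      finally show ?case using insert by simp
    qed
    then show ?thesis by blast
  qed
  have "basis (\<phi> ` L)"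
    unfolding basis_def
  proof (intro conjI)
    show sub: "\<phi> ` L \<subseteq> carrier V" using mono by (auto simp: V \<phi>_def)
    have coeffs: "\<exists>c. \<forall>s\<in>L. a (\<phi> s) = M +>\<^bsub>R\<^esub> fps_const (c s)" if "a \<in> \<phi> ` L \<rightarrow> carrier (R Quot M)" for a
    proof (rule bchoice, rule ballI)
      fix s assume "s \<in> L"
      then have "a (\<phi> s) \<in> carrier (R Quot M)" using that by blast
      then obtain f where f: "f \<in> carrier R" "a (\<phi> s) = M +>\<^bsub>R\<^esub> f" by (auto simp: Q)
      have "f - fps_const (fps_nth f 0) \<in> M" using f(1) by (auto simp: M C split: if_splits)
      then have "f \<in> M +>\<^bsub>R\<^esub> fps_const (fps_nth f 0)" by (force simp: a_r_coset_def r_coset_def ops)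
      then have "a (\<phi> s) = M +>\<^bsub>R\<^esub> fps_const (fps_nth f 0)"
        unfolding f(2) by (intro max.a_repr_independence'[symmetric]) (auto simp: const)
      then show "\<exists>c. a (\<phi> s) = M +>\<^bsub>R\<^esub> fps_const c" ..
    qed
    show "lin_indpt (\<phi> ` L)"
    proof (rule finite_lin_indpt2)
      fix a assume a: "a \<in> \<phi> ` L \<rightarrow> carrier (R Quot M)" "lincomb a (\<phi> ` L) = \<zero>\<^bsub>V\<^esub>"
      then obtain c where c: "\<And>s. s \<in> L \<Longrightarrow> a (\<phi> s) = M +>\<^bsub>R\<^esub> fps_const (c s)"
        using coeffs[OF a(1)] by auto
      let ?f = "\<Sum>s\<in>L. fps_const (c s) * fps_X ^ s"
      have "J +>\<^bsub>R\<^esub> ?f = J" using a(2) lincomb[of a c, OF c] by (simp add: V(3))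
      moreover have "0 + ?f \<in> J +>\<^bsub>R\<^esub> ?f" by (auto simp: a_r_coset_def r_coset_def ops J)
      ultimately have f_J: "?f \<in> J" by simp
      have c_0: "c s = 0" if "s \<in> L" for s
      proof (rule ccontr)
        assume "c s \<noteq> 0"
        then have "fps_nth ?f s \<noteq> 0" using that by (simp add: nth)
        then show False using f_J that unfolding J L_def by blast
      qed
      show "\<forall>v\<in>\<phi> ` L. a v = \<zero>\<^bsub>R Quot M\<^esub>"
        using c c_0 S.a_coset_add_zero[OF max.a_subset, unfolded ops] by (simp add: Q(2))
    qed (use L sub in auto)
    show "gen_set (\<phi> ` L)"
    proof
      show "span (\<phi> ` L) \<subseteq> carrier V" using sub by (rule span_is_subset2)
      show "carrier V \<subseteq> span (\<phi> ` L)"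
      proof
        fix v assume "v \<in> carrier V"
        then obtain f where f: "f \<in> I" "v = J +>\<^bsub>R\<^esub> f" by (auto simp: V)
        define c where "c s = fps_nth f s" for s
        let ?g = "\<Sum>s\<in>L. fps_const (c s) * fps_X ^ s"
        let ?a = "\<lambda>v. M +>\<^bsub>R\<^esub> fps_const (c (the_inv_into L \<phi> v))"
        have "k \<in> sums_of_length G (Suc n)" if "fps_nth (f - ?g) k \<noteq> 0" for k
          using that f(1) nth[OF order.refl, of c k] by (cases "k \<in> L") (auto simp: I L_def c_def)
        then have "f - ?g \<in> J" by (simp add: J)
        moreover have "?g \<in> I" by (rule sum_I) simp
        ultimately have "v = J +>\<^bsub>R\<^esub> ?g" using coset_eq f by blast
        also have "\<dots> = lincomb ?a (\<phi> ` L)"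
          by (rule lincomb[symmetric]) (simp add: the_inv_into_f_f[OF inj])
        finally have "v = lincomb ?a (\<phi> ` L)" .
        moreover have "?a \<in> \<phi> ` L \<rightarrow> carrier (R Quot M)" by (auto simp: Q const)
        ultimately show "v \<in> span (\<phi> ` L)" using L unfolding span_def by blast
      qed
    qed
  qed
  then have "dim = card (\<phi> ` L)" using L by (intro dim_basis) auto
  then have "dim = card L" by (simp only: card_image[OF inj])
  then show ?thesis by (simp add: hilbert_function_def V_def R_def M_def L_def)
qed

section \<open>Relations among the generators\<close>

text \<open>
  The parameters are \<open>\<alpha>\<^sub>2\<^sub>1 = p\<close>, \<open>\<alpha>\<^sub>2 = p + 1 + \<delta>\<close>, \<open>\<alpha>\<^sub>3 = h + 1\<close>, \<open>\<alpha>\<^sub>4 = m + 1\<close> and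
  \<open>\<alpha>\<^sub>1 = p + 1 + g\<close>, chosen so that they are arbitrary positive integers and no subtraction
  occurs in the relations. These are the values of the five binomials that generate Komeda's
  presentation of the semigroup ring, for example \<open>X\<^sub>1\<^sup>p X\<^sub>4 = X\<^sub>2\<^sup>p\<^sup>+\<^sup>1\<^sup>+\<^sup>\<delta>\<close> for \<open>rel2\<close>.
  Positivity of \<open>\<delta>\<close> is the hypothesis \<open>\<alpha>\<^sub>2 > \<alpha>\<^sub>2\<^sub>1 + 1\<close>.
\<close>

locale pseudo_symmetric_relations =
  fixes n1 n2 n3 n4 p \<delta> g h m :: nat
  assumes pos: "0 < n1" and less: "n1 < n2" "n2 < n3" "n3 < n4"
    and gcd: "gcd n1 (gcd n2 (gcd n3 n4)) = 1"
    and params: "0 < p" "0 < \<delta>" "0 < g" "0 < h" "0 < m"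
    and n1_eq: "n1 = (p + 1 + \<delta>) * (h + 1) * m + 1"
    and rel1: "(p + 1 + g) * n1 = n3 + m * n4"
    and rel2: "(p + 1 + \<delta>) * n2 = p * n1 + n4"
    and rel3: "(h + 1) * n3 = g * n1 + n2"
    and rel4: "(m + 1) * n4 = n1 + (p + \<delta>) * n2 + h * n3"
    and rel5: "(p + 1) * n1 + h * n3 = n2 + m * n4"
begin

text \<open>
  A quadruple \<open>(a, b, c, d)\<close> stands for the monomial \<open>X\<^sub>1\<^sup>a X\<^sub>2\<^sup>b X\<^sub>3\<^sup>c X\<^sub>4\<^sup>d\<close>, hence for a
  factorization of the semigroup element \<^term>\<open>val (a, b, c, d)\<close>.
\<close>

fun val :: "nat \<times> nat \<times> nat \<times> nat \<Rightarrow> nat" where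
  "val (a, b, c, d) = a * n1 + b * n2 + c * n3 + d * n4"

fun len :: "nat \<times> nat \<times> nat \<times> nat \<Rightarrow> nat" where
  "len (a, b, c, d) = a + b + c + d"

lemma len_le_val: "len x \<le> val x"
proof (cases x)
  case (fields a b c d)
  have "a \<le> a * n1" "b \<le> b * n2" "c \<le> c * n3" "d \<le> d * n4"
    using pos less by simp_all
  then show ?thesis unfolding fields val.simps len.simps by linarith
qed

text \<open>
  The exponent \<open>\<alpha>\<^sub>2\<close>, and the exponents of \<open>X\<^sub>2\<close> and \<open>X\<^sub>1\<close> after \<open>rel2\<close> has removed all the factors
  \<open>X\<^sub>4\<close> from \<open>rel1\<close> (see \<open>relPQ\<close>).
\<close>

definition A where "A = p + 1 + \<delta>"
definition P where "P = m * A"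
definition Q where "Q = p + 1 + g + m * p"

lemma A_pos: "0 < A" and P_pos: "0 < P"
  using params by (simp_all add: A_def P_def)

text \<open>
  The relation \<open>rel1\<close> combined with \<open>k\<close> copies of \<open>rel2\<close>: each copy trades one factor
  \<open>X\<^sub>4\<close> for \<open>X\<^sub>2\<^sup>A\<close>, at the price of \<open>X\<^sub>1\<^sup>p\<close> on the other side.
\<close>

lemma rel6:
  assumes "k \<le> m"
  shows "k * A * n2 + n3 + (m - k) * n4 = (p + 1 + g + k * p) * n1"
proof -
  obtain r where m: "m = k + r" using assms le_Suc_ex by blast
  have "k * ((p + 1 + \<delta>) * n2) = k * (p * n1 + n4)" by (simp only: rel2)
  then show ?thesis using rel1 unfolding m A_def by (simp add: algebra_simps)
qed

lemma relPQ: "P * n2 + n3 = Q * n1"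
  using rel6[of m] by (simp add: P_def Q_def)

text \<open>
  The relation \<open>rel5\<close> combined with \<open>k\<close> copies of \<open>rel2\<close> and \<open>i\<close> copies of \<open>relPQ\<close>.
  This two-parameter family is what makes the leading monomials of the tangent cone depend on the
  sizes of the parameters: either side can be the shorter one.
\<close>

lemma rel7:
  assumes "k \<le> m" "i \<le> h"
  shows "(1 + k * A + i * P) * n2 + (m - k) * n4 = (1 + (k + 1) * p + i * Q) * n1 + (h - i) * n3"
proof -
  obtain r where m: "m = k + r" using assms le_Suc_ex by blast
  obtain s where h: "h = i + s" using assms le_Suc_ex by blast
  have 1: "k * (A * n2) = k * (p * n1 + n4)" using rel2 by (simp only: A_def)
  have 2: "i * (P * n2 + n3) = i * (Q * n1)" by (simp only: relPQ)
  have 3: "(p + 1) * n1 + (i + s) * n3 = n2 + (k + r) * n4" using rel5 unfolding m h .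
  have "m - k = r" "h - i = s" by (simp_all add: m h)
  then show ?thesis using 1 2 3 by (simp add: algebra_simps)
qed

text \<open>A power of \<open>X\<^sub>1\<close> is longer than any other factorization, because \<open>n1\<close> is the least generator.\<close>

lemma length_less:
  assumes eq: "a * n1 = b * n2 + c * n3 + d * n4" and ne: "0 < b + c + d"
  shows "b + c + d < a"
proof (rule ccontr)
  assume "\<not> ?thesis"
  then have "a * n1 \<le> (b + c + d) * n1" by simp
  also have "\<dots> < b * n2 + c * n3 + d * n4"
  proof -
    have "b * n1 \<le> b * n2" "c * n1 \<le> c * n3" "d * n1 \<le> d * n4" using less by simp_all
    moreover have "b * n1 < b * n2 \<or> c * n1 < c * n3 \<or> d * n1 < d * n4"
      using ne less by auto
    ultimately show ?thesis unfolding add_mult_distrib by linarith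
  qed
  finally show False using eq by simp
qed

lemma length_rel6:
  assumes "k \<le> m"
  shows "k * A + 1 + (m - k) < p + 1 + g + k * p"
  by (rule length_less) (use rel6[OF assms] in auto)

text \<open>
  The amount by which the two sides of \<open>relPQ\<close> differ in length; positive by the preceding lemma.
\<close>

definition \<beta> where "\<beta> = g + p - m * (\<delta> + 1)"

lemma g_p_eq: "g + p = \<beta> + m * (\<delta> + 1)" and \<beta>_pos: "0 < \<beta>"
  using length_rel6[of m] by (simp_all add: \<beta>_def A_def algebra_simps)

lemma Q_eq: "Q = P + \<beta> + 1"
  using g_p_eq by (simp add: Q_def P_def A_def algebra_simps)

lemma h_less_g: "h < g"
proof (rule ccontr)
  assume "\<not> h < g"
  then have "g * n1 \<le> h * n3" using less by (intro mult_le_mono) auto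
  then show False using rel3 less by simp
qed

lemma m_less: "m < p + h"
proof (rule ccontr)
  assume "\<not> m < p + h"
  have "p * n1 + h * n3 \<le> (p + h) * n4"
    unfolding add_mult_distrib using less by (intro add_mono mult_le_mono) auto
  also have "\<dots> \<le> m * n4" using \<open>\<not> m < p + h\<close> by simp
  finally show False using rel5 less by simp
qed

lemma m_less': "m < p + \<delta> + h"
proof (rule ccontr)
  assume "\<not> m < p + \<delta> + h"
  have "(p + \<delta>) * n2 + h * n3 \<le> (p + \<delta> + h) * n4"
    unfolding add_mult_distrib[of "p + \<delta>" h] using less by (intro add_mono mult_le_mono) auto
  also have "\<dots> \<le> m * n4" using \<open>\<not> m < p + \<delta> + h\<close> by simp
  finally show False using rel4 less by simp
qed

text \<open>
  The left side of \<open>rel7\<close> (with parameters \<open>i\<close> and \<open>k\<close>) is at most as long as the right side,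
  so that it is the leading monomial for the tangent cone. Raising \<open>k\<close> lengthens the left side by
  \<open>\<delta>\<close> relative to the right, raising \<open>i\<close> shortens it by \<open>\<beta>\<close>.
\<close>

definition left_leads :: "nat \<Rightarrow> nat \<Rightarrow> bool" where
  "left_leads i k \<longleftrightarrow> m + k * \<delta> \<le> h + p + i * \<beta>"

lemma left_leads_iff:
  assumes "k \<le> m" "i \<le> h"
  shows "left_leads i k \<longleftrightarrow> 1 + k * A + i * P + (m - k) \<le> 1 + (k + 1) * p + i * Q + (h - i)"
proof -
  obtain r where m: "m = k + r" using assms le_Suc_ex by blast
  obtain s where h: "h = i + s" using assms le_Suc_ex by blast
  have "m - k = r" "h - i = s" by (simp_all add: m h)
  moreover have "k * A = k * p + k + k * \<delta>" by (simp add: A_def algebra_simps)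
  moreover have "i * Q = i * P + i * \<beta> + i" by (simp add: Q_eq algebra_simps)
  ultimately show ?thesis unfolding left_leads_def by (simp add: m h algebra_simps)
qed

lemma left_leads_0: "left_leads i 0"
  using m_less by (simp add: left_leads_def)

text \<open>For \<open>i = h\<close> no \<open>X\<^sub>3\<close> is left on the right side of \<open>rel7\<close>, which is then a power of \<open>X\<^sub>1\<close>.\<close>

lemma left_leads_h:
  assumes "k \<le> m"
  shows "left_leads h k"
proof -
  have "(1 + k * A + h * P) + 0 + (m - k) < 1 + (k + 1) * p + h * Q"
    by (rule length_less) (use rel7[OF assms order.refl] in auto)
  then show ?thesis using left_leads_iff[OF assms order.refl] by simp
qed

lemma left_leads_mono:
  assumes "left_leads i k" "i \<le> i'" "k' \<le> k"
  shows "left_leads i' k'"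
proof -
  have "i * \<beta> \<le> i' * \<beta>" "k' * \<delta> \<le> k * \<delta>" using assms(2,3) by simp_all
  then show ?thesis using assms(1) unfolding left_leads_def by linarith
qed

section \<open>Normal forms\<close>

text \<open>
  The monomials divisible by none of the leading (shorter) monomials of the relations: \<open>rel3\<close>
  and \<open>rel4\<close> bound \<open>c\<close> and \<open>d\<close>, \<open>rel2\<close> excludes \<open>X\<^sub>1\<^sup>p X\<^sub>4\<close>, the next condition comes from
  \<open>rel6\<close> (for \<open>d = m\<close> from \<open>rel1\<close>), and the last two come from the left and right sides of
  \<open>rel7\<close>, whichever leads.
\<close>

definition normal_monomials :: "(nat \<times> nat \<times> nat \<times> nat) set" where
  "normal_monomials = {(a, b, c, d). c \<le> h \<and> d \<le> m \<and> (0 < d \<longrightarrow> a < p) \<and>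
     (0 < c \<longrightarrow> b < (m - d) * A) \<and>
     (c = 0 \<longrightarrow> (\<forall>i\<le>h. left_leads i (m - d) \<longrightarrow> b \<le> (m - d) * A + i * P)) \<and>
     (0 < c \<and> d = 0 \<longrightarrow> (\<forall>k\<le>m. \<not> left_leads (h - c) k \<longrightarrow> a \<le> (k + 1) * p + (h - c) * Q))}"

text \<open>
  A longest factorization is divisible by no leading monomial, since replacing that monomial by
  the other side of its relation would lengthen it. Only \<open>rel7\<close> may have two sides of equal
  length; the left side is then replaced, which lowers the exponent of \<open>X\<^sub>2\<close>. Choosing that
  exponent minimal among the longest factorizations therefore yields a normal monomial.
\<close>

lemma normal_form_exists: "\<exists>y\<in>normal_monomials. val y = val x \<and> len x \<le> len y"
proof -
  obtain y0 where y0: "val y0 = val x" and max_len: "\<And>z. val z = val x \<Longrightarrow> len z \<le> len y0"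
    using ex_has_greatest_nat[of "\<lambda>z. val z = val x" x len "Suc (val x)"] len_le_val
    by (metis less_Suc_eq_le)
  obtain y where y: "val y = val x" "len y = len y0"
    and min_b: "\<And>z. val z = val x \<Longrightarrow> len z = len y0 \<Longrightarrow> fst (snd y) \<le> fst (snd z)"
    using ex_has_least_nat[of "\<lambda>z. val z = val x \<and> len z = len y0" y0 "\<lambda>z. fst (snd z)"] y0 by blast
  obtain a b c d where abcd: "y = (a, b, c, d)" by (cases y)
  have better: False if "val (a', b', c', d') = val (a, b, c, d)"
    "a + b + c + d < a' + b' + c' + d' \<or> a + b + c + d \<le> a' + b' + c' + d' \<and> b' < b" for a' b' c' d'
  proof -
    have v: "val (a', b', c', d') = val x" using that(1) y(1) abcd by simp
    have "a' + b' + c' + d' \<le> a + b + c + d"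
      using max_len[OF v] y(2) abcd by simp
    with that(2) have "len (a', b', c', d') = len y0" "b' < b" using y(2) abcd by auto
    with min_b[OF v] show False by (simp add: abcd)
  qed
  have "c \<le> h"
  proof (rule ccontr)
    assume "\<not> c \<le> h"
    then obtain t where t: "c = h + 1 + t" by (metis le_Suc_ex not_less_eq_eq Suc_eq_plus1)
    show False
      by (rule better[of "a + g" "b + 1" t d]) (use rel3 h_less_g in \<open>simp_all add: t algebra_simps\<close>)
  qed
  moreover have "d \<le> m"
  proof (rule ccontr)
    assume "\<not> d \<le> m"
    then obtain t where t: "d = m + 1 + t" by (metis le_Suc_ex not_less_eq_eq Suc_eq_plus1)
    show False
      by (rule better[of "a + 1" "b + (p + \<delta>)" "c + h" t]) (use rel4 m_less' in \<open>simp_all add: t algebra_simps\<close>)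
  qed
  moreover have "a < p" if d_pos: "0 < d"
  proof (rule ccontr)
    assume "\<not> a < p"
    then obtain t where t: "a = p + t" by (metis le_Suc_ex not_less)
    obtain d' where d': "d = Suc d'" using d_pos by (cases d) auto
    show False
      by (rule better[of t "b + A" c d']) (use rel2 params in \<open>simp_all add: A_def t d' algebra_simps\<close>)
  qed
  moreover have "b < (m - d) * A" if c_pos: "0 < c"
  proof (rule ccontr)
    assume "\<not> b < (m - d) * A"
    then obtain t where t: "b = (m - d) * A + t" by (metis le_Suc_ex not_less)
    obtain c' where c': "c = Suc c'" using c_pos by (cases c) auto
    have d: "m - (m - d) = d" using \<open>d \<le> m\<close> by simp
    show False
      by (rule better[of "a + (p + 1 + g + (m - d) * p)" t c' 0])
        (use rel6[of "m - d"] length_rel6[of "m - d"] in \<open>simp_all add: t c' d algebra_simps\<close>)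
  qed
  moreover have "b \<le> (m - d) * A + i * P" if "c = 0" "i \<le> h" "left_leads i (m - d)" for i
  proof (rule ccontr)
    assume "\<not> ?thesis"
    then obtain t where t: "b = (1 + (m - d) * A + i * P) + t"
      by (metis le_Suc_ex not_less_eq_eq plus_1_eq_Suc add_Suc)
    have d: "m - (m - d) = d" using \<open>d \<le> m\<close> by simp
    have "(1 + (m - d) * A + i * P) * n2 + d * n4 = (1 + (m - d + 1) * p + i * Q) * n1 + (h - i) * n3"
      using rel7[of "m - d" i] that d by simp
    moreover have "1 + (m - d) * A + i * P + d \<le> 1 + (m - d + 1) * p + i * Q + (h - i)"
      using left_leads_iff[of "m - d" i] that d by simp
    ultimately show False
      by (intro better[of "a + (1 + (m - d + 1) * p + i * Q)" t "h - i" 0])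
        (simp_all add: t that(1) add_mult_distrib)
  qed
  moreover have "a \<le> (k + 1) * p + (h - c) * Q"
    if "0 < c" "d = 0" "k \<le> m" "\<not> left_leads (h - c) k" for k
  proof (rule ccontr)
    assume "\<not> ?thesis"
    then obtain t where t: "a = (1 + (k + 1) * p + (h - c) * Q) + t"
      by (metis le_Suc_ex not_less_eq_eq plus_1_eq_Suc add_Suc)
    have c: "h - (h - c) = c" using \<open>c \<le> h\<close> by simp
    have "(1 + k * A + (h - c) * P) * n2 + (m - k) * n4 = (1 + (k + 1) * p + (h - c) * Q) * n1 + c * n3"
      using rel7[of k "h - c"] that c by simp
    moreover have "1 + (k + 1) * p + (h - c) * Q + c < 1 + k * A + (h - c) * P + (m - k)"
      using left_leads_iff[of k "h - c"] that c by simp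
    ultimately show False
      by (intro better[of t "b + (1 + k * A + (h - c) * P)" 0 "m - k"])
        (simp_all add: t that(2) add_mult_distrib)
  qed
  ultimately have "(a, b, c, d) \<in> normal_monomials" unfolding normal_monomials_def by blast
  moreover have "len x \<le> len y" using max_len[of x] y(2) by simp
  ultimately show ?thesis using y(1) abcd by blast
qed


text \<open>
  A second system of normal forms, easier to count: apart from the exponent of \<open>X\<^sub>1\<close> there are
  exactly \<open>n1\<close> choices, which turn out to be the elements of the Apery set of \<open>n1\<close>.
\<close>

definition apery :: "(nat \<times> nat \<times> nat \<times> nat) set" where
  "apery = {(a, b, c, d). b < A \<and> c \<le> h \<and> d < m \<or> b = 0 \<and> c = 0 \<and> d = m}"

text \<open>Here a factorization with the largest exponent of \<open>X\<^sub>1\<close> is taken: every relation raises it in one direction.\<close>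

lemma apery_form_exists: "\<exists>y\<in>apery. val y = val x"
proof -
  have bound: "fst y \<le> val y" for y
  proof -
    obtain a b c d where "y = (a, b, c, d)" by (cases y)
    then show ?thesis using len_le_val[of y] by simp
  qed
  obtain y where y: "val y = val x" and max: "\<And>z. val z = val x \<Longrightarrow> fst z \<le> fst y"
    using ex_has_greatest_nat[of "\<lambda>z. val z = val x" x fst "Suc (val x)"] bound
    by (metis less_Suc_eq_le)
  obtain a b c d where abcd: "y = (a, b, c, d)" by (cases y)
  have better: False if "val (a', b', c', d') = val (a, b, c, d)" "a < a'" for a' b' c' d'
    using max[of "(a', b', c', d')"] that y abcd by simp
  have "b < A"
  proof (rule ccontr)
    assume "\<not> b < A"
    then obtain t where t: "b = A + t" by (metis le_Suc_ex not_less)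
    show False
      by (rule better[of "a + p" t c "d + 1"]) (use rel2 params in \<open>simp_all add: A_def t algebra_simps\<close>)
  qed
  moreover have "c \<le> h"
  proof (rule ccontr)
    assume "\<not> c \<le> h"
    then obtain t where t: "c = h + 1 + t" by (metis le_Suc_ex not_less_eq_eq Suc_eq_plus1)
    show False
      by (rule better[of "a + g" "b + 1" t d]) (use rel3 params in \<open>simp_all add: t algebra_simps\<close>)
  qed
  moreover have "d \<le> m"
  proof (rule ccontr)
    assume "\<not> d \<le> m"
    then obtain t where t: "d = m + 1 + t" by (metis le_Suc_ex not_less_eq_eq Suc_eq_plus1)
    show False
      by (rule better[of "a + 1" "b + (p + \<delta>)" "c + h" t]) (use rel4 in \<open>simp_all add: t algebra_simps\<close>)
  qed
  moreover have "b = 0" if d_eq: "d = m"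
  proof (rule ccontr)
    assume "b \<noteq> 0"
    then obtain t where t: "b = Suc t" by (cases b) auto
    show False
      by (rule better[of "a + (p + 1)" t "c + h" 0]) (use rel5 in \<open>simp_all add: t d_eq algebra_simps\<close>)
  qed
  moreover have "c = 0" if d_eq: "d = m"
  proof (rule ccontr)
    assume "c \<noteq> 0"
    then obtain t where t: "c = Suc t" by (cases c) auto
    show False
      by (rule better[of "a + (p + 1 + g)" b t 0]) (use rel1 in \<open>simp_all add: t d_eq algebra_simps\<close>)
  qed
  ultimately have "y \<in> apery" unfolding apery_def abcd by auto
  with y show ?thesis by blast
qed

lemma residue_exists: "\<exists>x. val x mod n1 = r mod n1"
proof -
  obtain u3 u4 where 1: "u3 * int n3 + u4 * int n4 = gcd (int n3) (int n4)"
    using bezout_int by blast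
  obtain u2 v where 2: "u2 * int n2 + v * gcd (int n3) (int n4) = gcd (int n2) (gcd (int n3) (int n4))"
    using bezout_int by blast
  obtain u1 w where 3: "u1 * int n1 + w * gcd (int n2) (gcd (int n3) (int n4))
      = gcd (int n1) (gcd (int n2) (gcd (int n3) (int n4)))"
    using bezout_int by blast
  have "gcd (int n1) (gcd (int n2) (gcd (int n3) (int n4))) = 1"
    using gcd by simp
  then have one: "u1 * int n1 + (w * u2 * int n2 + w * v * u3 * int n3 + w * v * u4 * int n4) = 1"
    using 1 2 3 by (metis (no_types, opaque_lifting) add.assoc distrib_left mult.assoc)
  define e where "e z = nat ((int r * z) mod int n1)" for z
  have e: "int (e z) = (int r * z) mod int n1" for z
    using pos by (simp add: e_def)
  have "int (val (0, e (w * u2), e (w * v * u3), e (w * v * u4))) mod int n1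
      = (int r * (w * u2) * int n2 + int r * (w * v * u3) * int n3 + int r * (w * v * u4) * int n4) mod int n1"
    by (auto simp: e intro!: mod_add_cong mod_mult_cong)
  also have "int r * (w * u2) * int n2 + int r * (w * v * u3) * int n3 + int r * (w * v * u4) * int n4
      = int r * (w * u2 * int n2 + w * v * u3 * int n3 + w * v * u4 * int n4)"
    by (simp add: algebra_simps)
  also have "w * u2 * int n2 + w * v * u3 * int n3 + w * v * u4 * int n4 = 1 - u1 * int n1"
    using one by linarith
  also have "int r * (1 - u1 * int n1) = int r + (- int r * u1) * int n1" by (simp add: algebra_simps)
  also have "\<dots> mod int n1 = int r mod int n1" by (rule mod_mult_self1)
  finally show ?thesis by (metis of_nat_eq_iff of_nat_mod)
qed

text \<open>
  The Apery forms represent every residue class modulo \<open>n1\<close>, and the formula for \<open>n1\<close> says that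
  there are only \<open>n1\<close> of them up to the exponent of \<open>X\<^sub>1\<close>; so they represent each class once.
\<close>

lemma apery_form_unique:
  assumes "x \<in> apery" "y \<in> apery" "val x = val y"
  shows "x = y"
proof -
  define W where "W = {..<A} \<times> {..h} \<times> {..<m} \<union> {(0, 0, m)}"
  let ?w = "\<lambda>(b, c, d). (b * n2 + c * n3 + d * n4) mod n1"
  have fin: "finite W" unfolding W_def by simp
  have "card W \<le> card ({..<A} \<times> {..h} \<times> {..<m}) + card {(0::nat, 0::nat, m)}"
    unfolding W_def by (rule card_Un_le)
  also have "\<dots> = n1" by (simp add: card_cartesian_product n1_eq A_def algebra_simps)
  finally have card: "card W \<le> card {..<n1}" by simp
  have "{..<n1} \<subseteq> ?w ` W"
  proof
    fix r assume r: "r \<in> {..<n1}"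
    obtain z where z: "val z mod n1 = r mod n1" using residue_exists by blast
    obtain a b c d where abcd: "(a, b, c, d) \<in> apery" "val (a, b, c, d) = val z"
      using apery_form_exists[of z] by (metis prod_cases4)
    have "r = val (a, b, c, d) mod n1" using abcd(2) z r by simp
    also have "\<dots> = ?w (b, c, d)" by (simp add: add.assoc)
    finally have "r = ?w (b, c, d)" .
    moreover have "(b, c, d) \<in> W" using abcd(1) by (auto simp: apery_def W_def)
    ultimately show "r \<in> ?w ` W" by blast
  qed
  then have img: "?w ` W = {..<n1}" using pos by auto
  then have "card (?w ` W) = card W"
    using card card_image_le[OF fin, of ?w] by simp
  then have inj: "inj_on ?w W" by (rule eq_card_imp_inj_on[OF fin])
  obtain a b c d where x: "x = (a, b, c, d)" by (cases x)
  obtain a' b' c' d' where y: "y = (a', b', c', d')" by (cases y)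
  have "(b, c, d) \<in> W" "(b', c', d') \<in> W" using assms by (auto simp: apery_def W_def x y)
  moreover have "?w (b, c, d) = val x mod n1" "?w (b', c', d') = val y mod n1"
    by (simp_all add: x y add.assoc)
  ultimately have "(b, c, d) = (b', c', d')"
    using inj_onD[OF inj] assms(3) by metis
  moreover from this have "a = a'" using assms(3) pos by (simp add: x y)
  ultimately show ?thesis by (simp add: x y)
qed

text \<open>
  Rewriting a normal monomial into its Apery form: powers \<open>X\<^sub>2\<^sup>A\<close> are turned into \<open>X\<^sub>1\<^sup>p X\<^sub>4\<close>,
  unless the exponent of \<open>X\<^sub>2\<close> is so large (which requires \<open>c = 0\<close>) that a left side of \<open>rel7\<close>
  divides the monomial; then that relation is applied first, with \<open>i\<close> as large as possible.
\<close>

lemma normal_apery_form: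
  assumes "(a, b, c, d) \<in> normal_monomials"
  obtains (wrap) q r where "b = q * A + r" "(a + q * p, r, c, d + q) \<in> apery"
      "val (a, b, c, d) = val (a + q * p, r, c, d + q)"
    | (long) i q r where "c = 0" "i < h" "\<not> left_leads i (m - d)" "b = 1 + (m - d) * A + i * P + q * A + r"
      "(a + (1 + (m - d + 1) * p + i * Q) + q * p, r, h - i, q) \<in> apery"
      "val (a, b, c, d) = val (a + (1 + (m - d + 1) * p + i * Q) + q * p, r, h - i, q)"
proof -
  have d: "d \<le> m" and c: "c \<le> h" and c_pos: "0 < c \<Longrightarrow> b < (m - d) * A"
    and c_0: "\<And>i. c = 0 \<Longrightarrow> i \<le> h \<Longrightarrow> left_leads i (m - d) \<Longrightarrow> b \<le> (m - d) * A + i * P"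
    using assms unfolding normal_monomials_def by blast+
  have wrap_val: "val (a, q * A + r, c, d) = val (a + q * p, r, c, d + q)" for a q r c d
  proof -
    have "q * (A * n2) = q * (p * n1 + n4)" using rel2 by (simp only: A_def)
    then show ?thesis by (simp add: algebra_simps)
  qed
  show ?thesis
  proof (cases "c = 0 \<and> (m - d) * A < b")
    case False
    define q r where "q = b div A" and "r = b mod A"
    have r: "r < A" using A_pos by (simp add: r_def)
    have b: "b = q * A + r" unfolding q_def r_def by (rule div_mult_mod_eq[symmetric])
    have "(r, c, d + q) \<in> {(r, c, d). c \<le> h \<and> (r < A \<and> d < m \<or> r = 0 \<and> c = 0 \<and> d = m)}"
    proof (cases "q < m - d")
      case True
      then show ?thesis using r c by auto
    next
      case q: False
      have "(m - d) * A \<le> q * A" using q by (intro mult_le_mono1) simp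
      then have "(m - d) * A \<le> b" unfolding b by (rule trans_le_add1)
      then have "c = 0" using c_pos leD by blast
      then have b_le: "b \<le> (m - d) * A" using False by simp
      have "q * A \<le> b" unfolding b by simp
      then have "q * A \<le> (m - d) * A" using b_le by (rule order.trans)
      then have "q = m - d" using A_pos q by simp
      then show ?thesis using b_le b d \<open>c = 0\<close> by simp
    qed
    then have "(a + q * p, r, c, d + q) \<in> apery" unfolding apery_def by blast
    moreover have "val (a, b, c, d) = val (a + q * p, r, c, d + q)" unfolding b by (rule wrap_val)
    ultimately show ?thesis by (rule wrap[OF b])
  next
    case True
    define t where "t = b - (1 + (m - d) * A)"
    define i b' where "i = t div P" and "b' = t mod P"
    have t: "t = i * P + b'" unfolding i_def b'_def by (rule div_mult_mod_eq[symmetric])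
    then have b: "b = (1 + (m - d) * A + i * P) + b'"
      using True t unfolding t_def by linarith
    have b': "b' < P" using P_pos by (simp add: b'_def)
    have not_leads: "\<not> left_leads i (m - d)" if "i \<le> h"
      using c_0[OF _ that] True b by linarith
    have "i < h"
    proof (rule ccontr)
      assume "\<not> i < h"
      then have "h * P \<le> i * P" by simp
      moreover have "b \<le> (m - d) * A + h * P" using c_0[OF _ order.refl left_leads_h] True by simp
      ultimately show False using b by linarith
    qed
    define q r where "q = b' div A" and "r = b' mod A"
    have r: "r < A" using A_pos by (simp add: r_def)
    have b'_eq: "b' = q * A + r" unfolding q_def r_def by (rule div_mult_mod_eq[symmetric])
    have q: "q < m" using b' unfolding q_def P_def by (simp add: less_mult_imp_div_less)
    have "val (a, b, c, d) = val (a + (1 + (m - d + 1) * p + i * Q), b', h - i, 0)"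
      using rel7[of "m - d" i] \<open>i < h\<close> d True by (simp add: b add_mult_distrib)
    also have "\<dots> = val (a + (1 + (m - d + 1) * p + i * Q) + q * p, r, h - i, q)"
      unfolding b'_eq wrap_val by simp
    finally have "val (a, b, c, d) = val (a + (1 + (m - d + 1) * p + i * Q) + q * p, r, h - i, q)" .
    moreover have "(a + (1 + (m - d + 1) * p + i * Q) + q * p, r, h - i, q) \<in> apery"
      using q r unfolding apery_def by simp
    moreover have "b = 1 + (m - d) * A + i * P + q * A + r" using b b'_eq by simp
    moreover have "c = 0" "\<not> left_leads i (m - d)" using True not_leads \<open>i < h\<close> by simp_all
    ultimately show ?thesis using long \<open>i < h\<close> by blast
  qed
qed

text \<open>
  It suffices to recover the monomial from its Apery form. Within each of the two cases of
  \<open>normal_apery_form\<close>, the number of applications of \<open>rel2\<close> is determined because \<open>a < p\<close> as long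
  as \<open>X\<^sub>4\<close> remains. The two cases cannot meet, because a form from the second has an
  exponent of \<open>X\<^sub>1\<close> that exceeds the bound that the last clause of \<open>normal_monomials\<close> puts on the first.
\<close>

lemma normal_form_unique:
  assumes "x \<in> normal_monomials" "y \<in> normal_monomials" "val x = val y"
  shows "x = y"
proof -
  obtain a b c d where x: "x = (a, b, c, d)" by (cases x)
  obtain a' b' c' d' where y: "y = (a', b', c', d')" by (cases y)
  note N = assms(1)[unfolded x] and N' = assms(2)[unfolded y]
  have a_less: "a < p" if "(a, b, c, d) \<in> normal_monomials" "0 < d" for a b c d
    using that by (simp add: normal_monomials_def)
  have d_le: "d \<le> m" if "(a, b, c, d) \<in> normal_monomials" for a b c d
    using that by (simp add: normal_monomials_def)
  have q_le: "q \<le> q'" if "a + q * p = a' + q' * p" "d + q = d' + q'" "(a', b', c', d') \<in> normal_monomials"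
    for a d q a' b' c' d' q'
  proof (rule ccontr)
    assume "\<not> q \<le> q'"
    then obtain s where s: "q = q' + Suc s" using less_imp_Suc_add by fastforce
    then have "a' = a + Suc s * p" "d' = d + Suc s" using that by (simp_all add: algebra_simps)
    then show False using a_less[OF that(3)] by simp
  qed
  have mixed: False
    if N: "(a, b, c, d) \<in> normal_monomials" and i: "i < h" "\<not> left_leads i k" "k \<le> m"
      and eq: "(a + q * p, r, c, d + q) = (a' + (1 + (k + 1) * p + i * Q) + q' * p, r', h - i, q')"
    for a b c d q r i k a' q' r'
  proof -
    have "q' = d + q" and c: "c = h - i" and "a + q * p = a' + (1 + (k + 1) * p + i * Q) + q' * p"
      using eq by auto
    then have a: "a = a' + (1 + (k + 1) * p + i * Q) + d * p" by (simp add: algebra_simps)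
    then have "p \<le> a" by simp
    then have "d = 0" using a_less[OF N] by (cases d) auto
    moreover have "h - c = i" "0 < c" using c i by auto
    ultimately have "a \<le> (k + 1) * p + i * Q" using N i unfolding normal_monomials_def by auto
    with a show False by simp
  qed
  show ?thesis using N proof (cases rule: normal_apery_form)
    case (wrap q r)
    note x_form = this
    show ?thesis using N' proof (cases rule: normal_apery_form)
      case (wrap q' r')
      have eq: "(a + q * p, r, c, d + q) = (a' + q' * p, r', c', d' + q')"
        by (rule apery_form_unique[OF x_form(2) wrap(2)]) (use x_form(3) wrap(3) assms(3) in \<open>simp only: x y\<close>)
      then have "q = q'" using q_le[of a q a' q' d d'] q_le[of a' q' a q d' d] N N' by force
      with eq show ?thesis using x_form(1) wrap(1) by (simp add: x y)
    next
      case (long i q' r')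
      have "(a + q * p, r, c, d + q) = (a' + (1 + (m - d' + 1) * p + i * Q) + q' * p, r', h - i, q')"
        by (rule apery_form_unique[OF x_form(2) long(5)]) (use x_form(3) long(6) assms(3) in \<open>simp only: x y\<close>)
      then show ?thesis using mixed[OF N long(2,3)] by (meson diff_le_self)
    qed
  next
    case (long i q r)
    note x_form = this
    show ?thesis using N' proof (cases rule: normal_apery_form)
      case (wrap q' r')
      have "(a' + q' * p, r', c', d' + q') = (a + (1 + (m - d + 1) * p + i * Q) + q * p, r, h - i, q)"
        by (rule apery_form_unique[OF wrap(2) x_form(5)]) (use x_form(6) wrap(3) assms(3) in \<open>simp only: x y\<close>)
      then show ?thesis using mixed[OF N' x_form(2,3)] by (meson diff_le_self)
    next
      case (long i' q' r')
      have eq: "(a + (1 + (m - d + 1) * p + i * Q) + q * p, r, h - i, q)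
          = (a' + (1 + (m - d' + 1) * p + i' * Q) + q' * p, r', h - i', q')"
        by (rule apery_form_unique[OF x_form(5) long(5)]) (use x_form(6) long(6) assms(3) in \<open>simp only: x y\<close>)
      then have "i = i'" "q = q'" "r = r'" using x_form(2) long(2) by auto
      with eq have a: "a + (m - d) * p = a' + (m - d') * p" by simp
      have dd: "d + (m - d) = d' + (m - d')" using d_le[OF N] d_le[OF N'] by simp
      have "m - d = m - d'"
        using q_le[OF a dd N'] q_le[OF a[symmetric] dd[symmetric] N] by simp
      moreover from this have "d = d'" using dd by simp
      ultimately show ?thesis using a x_form(1,4) long(1,4) \<open>i = i'\<close> \<open>q = q'\<close> \<open>r = r'\<close> by (simp add: x y)
    qed
  qed
qed

lemma len_le_normal:
  assumes "y \<in> normal_monomials" "val x = val y"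
  shows "len x \<le> len y"
proof -
  obtain z where z: "z \<in> normal_monomials" "val z = val x" "len x \<le> len z"
    using normal_form_exists by blast
  have "z = y" by (rule normal_form_unique[OF z(1) assms(1)]) (simp only: z(2) assms(2))
  with z(3) show ?thesis by simp
qed

section \<open>An injection raising the length by one\<close>

text \<open>
  Multiplication by \<open>X\<^sub>1\<close> fails to preserve normality only at the boundary of the conditions that
  bound \<open>a\<close>. There the image is a monomial without \<open>X\<^sub>1\<close>. At the boundary \<open>X\<^sub>1\<^sup>p X\<^sub>4\<close> of
  \<open>rel2\<close>, the factor \<open>X\<^sub>1\<^sup>p\<^sup>-\<^sup>1 X\<^sub>4\<close> is replaced by \<open>X\<^sub>2\<^sup>p\<^sup>+\<^sup>1\<close>, which fits below \<open>X\<^sub>2\<^sup>A\<close>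
  because \<open>p + 1 < A\<close>. At the boundary of \<open>rel7\<close> the right side of that relation
  divides the product with \<open>X\<^sub>1\<close> and is shorter than the left side by some \<open>e\<close>; it is replaced by
  the left side divided by \<open>X\<^sub>2\<^sup>e\<close>, which has the same length. The parameter \<open>k\<close> of that
  relation is read off from \<open>a\<close>.
\<close>

definition shift :: "nat \<times> nat \<times> nat \<times> nat \<Rightarrow> nat \<times> nat \<times> nat \<times> nat" where
  "shift = (\<lambda>(a, b, c, d).
     if (a + 1, b, c, d) \<in> normal_monomials then (a + 1, b, c, d)
     else if 0 < d then (0, b + p + 1, c, d - 1)
     else let i = h - c; k = (a - i * Q) div p - 1
       in (0, b + 1 + k * A + i * P - (m + k * \<delta> - (h + p + i * \<beta>)), 0, m - k))"

text \<open>
  In the third case \<open>k\<close> is the least parameter for which the right side of \<open>rel7\<close> is strictly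
  shorter, since a smaller one would bound \<open>a\<close> more tightly. As each step of \<open>k\<close> changes
  the difference of the lengths by \<open>\<delta>\<close>, it follows that \<open>e \<le> \<delta>\<close>.
\<close>

lemma shift_cases:
  assumes "(a, b, c, d) \<in> normal_monomials"
  obtains (times) "(a + 1, b, c, d) \<in> normal_monomials" "shift (a, b, c, d) = (a + 1, b, c, d)"
    | (rel2) "0 < d" "a + 1 = p" "shift (a, b, c, d) = (0, b + p + 1, c, d - 1)"
    | (rel7) i k e where "d = 0" "0 < c" "c + i = h" "0 < k" "k \<le> m" "a = (k + 1) * p + i * Q" "b < P"
      "left_leads i (k - 1)" "m + k * \<delta> = h + p + i * \<beta> + e" "0 < e" "e \<le> \<delta>"
      "shift (a, b, c, d) = (0, b + 1 + k * A + i * P - e, 0, m - k)"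
proof (cases "(a + 1, b, c, d) \<in> normal_monomials")
  case True
  then show ?thesis by (intro times) (simp_all add: shift_def)
next
  case False
  note N = assms[unfolded normal_monomials_def, simplified]
  show ?thesis
  proof (cases "0 < d")
    case True
    then have "\<not> a + 1 < p" using False N by (auto simp: normal_monomials_def)
    then have "a + 1 = p" using N True by simp
    then show ?thesis using True False by (intro rel2) (simp_all add: shift_def)
  next
    case d: False
    define i where "i = h - c"
    obtain k where c: "0 < c" and k: "k \<le> m" "\<not> left_leads i k" and a_ge: "\<not> a + 1 \<le> (k + 1) * p + i * Q"
      using False d N by (auto simp: normal_monomials_def i_def)
    have "a \<le> (k + 1) * p + i * Q" using N c d k by (auto simp: i_def)
    then have a: "a = (k + 1) * p + i * Q" using a_ge by simp
    have k_pos: "0 < k" using k(2) left_leads_0 by (cases k) auto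
    have prev: "left_leads i (k - 1)"
    proof (rule ccontr)
      assume "\<not> left_leads i (k - 1)"
      then have "a \<le> (k - 1 + 1) * p + i * Q" using N c d k by (auto simp: i_def)
      then show False using k_pos params by (simp add: a)
    qed
    define e where "e = m + k * \<delta> - (h + p + i * \<beta>)"
    have e: "m + k * \<delta> = h + p + i * \<beta> + e" "0 < e"
      using k(2) by (simp_all add: e_def left_leads_def)
    have "k * \<delta> = (k - 1) * \<delta> + \<delta>" using k_pos by (cases k) auto
    then have "e \<le> \<delta>" using prev e(1) unfolding left_leads_def by linarith
    have "(a - i * Q) div p - 1 = k" using params by (simp add: a)
    then have "shift (a, b, c, d) = (0, b + 1 + k * A + i * P - e, 0, m - k)"
      using False d unfolding shift_def Let_def e_def by (simp flip: i_def)
    moreover have "b < P" "c + i = h" using N c d by (auto simp: P_def i_def)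
    ultimately show ?thesis using d c k(1) k_pos a prev e \<open>e \<le> \<delta>\<close> by (intro rel7) auto
  qed
qed

lemma shift_normal:
  assumes "x \<in> normal_monomials"
  shows "shift x \<in> normal_monomials \<and> len (shift x) = Suc (len x)"
proof -
  obtain a b c d where x: "x = (a, b, c, d)" by (cases x)
  note N = assms[unfolded x]
  note N' = N[unfolded normal_monomials_def, simplified]
  show ?thesis using N proof (cases rule: shift_cases)
    case times
    then show ?thesis by (simp add: x)
  next
    case rel2
    define k where "k = m - d"
    have k: "m - (d - 1) = Suc k" using rel2(1) N' by (auto simp: k_def)
    note N' = N'[folded k_def]
    have A: "p + 1 < A" using params by (simp add: A_def)
    have "b + p + 1 \<le> Suc k * A + i * P" if "c = 0" "i \<le> h" "left_leads i (Suc k)" for i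
    proof -
      have "left_leads i k" using that(3) by (rule left_leads_mono) auto
      then show ?thesis using that N' A by auto
    qed
    moreover have "b + p + 1 < Suc k * A" if "0 < c" using that N' A by simp
    ultimately have "shift x \<in> normal_monomials"
      using N' params rel2(1) unfolding x rel2(3) normal_monomials_def mem_Collect_eq prod.case k by auto
    then show ?thesis using rel2 by (simp add: x)
  next
    case (rel7 i k e)
    have mk: "m - (m - k) = k" using rel7(5) by simp
    have not_leads: "\<not> left_leads i k" using rel7(9,10) by (simp add: left_leads_def)
    \<comment> \<open>At \<open>k\<close> only parameters larger than \<open>i\<close> bound the exponent of \<open>X\<^sub>2\<close>, and \<open>b < P\<close> leaves room.\<close>
    have "b + 1 + k * A + i * P - e \<le> k * A + i' * P" if "left_leads i' k" for i'
    proof -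
      have "Suc i \<le> i'" using not_leads left_leads_mono[OF that] by (meson not_less_eq_eq order.refl)
      then have "Suc i * P \<le> i' * P" by (rule mult_le_mono1)
      then show ?thesis using rel7(7,10) by simp
    qed
    then have "shift x \<in> normal_monomials"
      using params rel7(5) unfolding x rel7(12) normal_monomials_def by (auto simp: mk)
    moreover have "len (shift x) = Suc (len x)"
    proof -
      have "e \<le> k * A"
        using rel7(4,11) by (cases k) (auto simp: A_def)
      moreover have "k * A = k * p + k + k * \<delta>" by (simp add: A_def algebra_simps)
      moreover have "i * Q = i * P + i * \<beta> + i" by (simp add: Q_eq algebra_simps)
      moreover have "len (shift x) = b + 1 + k * A + i * P - e + (m - k)"
        unfolding x rel7(12) by simp
      moreover have "len x = (k * p + p + i * Q) + b + c" unfolding x using rel7(1,6) by simp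
      ultimately show ?thesis using rel7(3,5,9) by linarith
    qed
    ultimately show ?thesis ..
  qed
qed

text \<open>
  Images under multiplication by \<open>X\<^sub>1\<close> are the ones divisible by it. The two kinds of images
  without \<open>X\<^sub>1\<close> are separated by the exponent of \<open>X\<^sub>2\<close>: the bound on \<open>b\<close> one step before \<open>k\<close> keeps
  it below \<open>(k - 1) A + i P + p + 2\<close> for the first kind, and \<open>e \<le> \<delta>\<close> keeps it at or above this
  number for the second. Images of the second kind with the same \<open>k\<close> and different \<open>i\<close> have
  exponents in disjoint intervals of length \<open>P\<close>.
\<close>

lemma shift_inj: "inj_on shift normal_monomials"
proof (rule inj_onI)
  fix x y assume xy: "x \<in> normal_monomials" "y \<in> normal_monomials" "shift x = shift y"
  obtain a b c d where x: "x = (a, b, c, d)" by (cases x)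
  obtain a' b' c' d' where y: "y = (a', b', c', d')" by (cases y)
  note N = xy(1)[unfolded x] and N' = xy(2)[unfolded y]
  have separate: False
    if N: "(a, b, c, d) \<in> normal_monomials" and d: "0 < d" and i: "i \<le> h" "left_leads i (k - 1)" "0 < k" "k \<le> m" "e \<le> \<delta>"
      and eq: "(0::nat, b + p + 1, c, d - 1) = (0, b' + 1 + k * A + i * P - e, 0, m - k)"
    for a b c d i k e b'
  proof -
    have k: "k = Suc (m - d)" using eq d i(3,4) by auto
    then have "b \<le> (m - d) * A + i * P" using N i(1,2) eq unfolding normal_monomials_def by auto
    moreover have "b + p + 1 = b' + 1 + (m - d) * A + (p + 1 + \<delta>) + i * P - e"
      using eq k by (simp add: A_def)
    ultimately show False using i(5) by linarith
  qed
  have ordered: "i' \<le> i"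
    if "m + k * \<delta> = h + p + i * \<beta> + e" "m + k * \<delta> = h + p + i' * \<beta> + e'" "b < P" "e \<le> \<delta>" "e' \<le> \<delta>" "0 < k"
      "b + 1 + k * A + i * P - e = b' + 1 + k * A + i' * P - e'" for i i' k e e' b b'
  proof (rule ccontr)
    assume "\<not> i' \<le> i"
    then have "Suc i \<le> i'" by simp
    then have "Suc i * P \<le> i' * P" "i * \<beta> \<le> i' * \<beta>" by (intro mult_le_mono1; simp)+
    then have "i * P + P \<le> i' * P" "i * \<beta> \<le> i' * \<beta>" by simp_all
    moreover have "\<delta> \<le> k * A" using that(6) by (cases k) (auto simp: A_def)
    ultimately show False using that(1-5,7) by linarith
  qed
  show "x = y"
  using N proof (cases rule: shift_cases)
    case times
    note x_form = this
    show ?thesis using N' by (cases rule: shift_cases) (use x_form xy(3) in \<open>auto simp: x y\<close>)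
  next
    case rel2
    note x_form = this
    show ?thesis using N' proof (cases rule: shift_cases)
      case times
      then show ?thesis using x_form xy(3) by (simp add: x y)
    next
      case rel2
      then show ?thesis using x_form xy(3) by (auto simp: x y)
    next
      case (rel7 i k e)
      have "(0, b + p + 1, c, d - 1) = (0, b' + 1 + k * A + i * P - e, 0, m - k)"
        using x_form(3) rel7(12) xy(3) by (simp add: x y)
      then show ?thesis using separate[OF N x_form(1) _ rel7(8,4,5,11)] rel7(3) by auto
    qed
  next
    case (rel7 i k e)
    note x_form = this
    show ?thesis using N' proof (cases rule: shift_cases)
      case times
      then show ?thesis using x_form xy(3) by (simp add: x y)
    next
      case rel2
      have "(0, b' + p + 1, c', d' - 1) = (0, b + 1 + k * A + i * P - e, 0, m - k)"
        using rel2(3) x_form(12) xy(3) by (simp add: x y)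
      then show ?thesis using separate[OF N' rel2(1) _ x_form(8,4,5,11)] x_form(3) by auto
    next
      case (rel7 i' k' e')
      have "m - k = m - k'" and b: "b + 1 + k * A + i * P - e = b' + 1 + k' * A + i' * P - e'"
        using x_form(12) rel7(12) xy(3) by (auto simp: x y)
      then have k: "k' = k" using x_form(5) rel7(5) by simp
      note b = b[unfolded k] and e' = rel7(9)[unfolded k]
      have "i = i'"
        using ordered[OF x_form(9) e' x_form(7,11) rel7(11) x_form(4) b]
          ordered[OF e' x_form(9) rel7(7,11) x_form(11,4) b[symmetric]] by simp
      moreover from this have "e = e'" using x_form(9) e' by simp
      moreover have "\<delta> \<le> k * A" using x_form(4) by (cases k) (auto simp: A_def)
      ultimately show ?thesis using x_form(1,3,6,11) rel7(1,3,6) b k by (simp add: x y)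
    qed
  qed
qed

lemma finite_normal_len: "finite {x \<in> normal_monomials. len x = n}"
proof (rule finite_subset)
  show "{x \<in> normal_monomials. len x = n} \<subseteq> {..n} \<times> {..n} \<times> {..n} \<times> {..n}" by auto
qed simp

lemma card_normal_len_mono: "card {x \<in> normal_monomials. len x = n} \<le> card {x \<in> normal_monomials. len x = Suc n}"
proof (rule card_inj_on_le)
  show "inj_on shift {x \<in> normal_monomials. len x = n}" using shift_inj by (rule inj_on_subset) auto
  show "shift ` {x \<in> normal_monomials. len x = n} \<subseteq> {x \<in> normal_monomials. len x = Suc n}" using shift_normal by auto
qed (rule finite_normal_len)

text \<open>The normal form is a longest factorization, so it counts each semigroup element at the right length.\<close>

lemma card_val_len:
  "card ({val x | x. n \<le> len x} - {val x | x. Suc n \<le> len x}) = card {x \<in> normal_monomials. len x = n}"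
proof -
  have "{val x | x. n \<le> len x} - {val x | x. Suc n \<le> len x} = val ` {x \<in> normal_monomials. len x = n}"
  proof (intro equalityI subsetI)
    fix s assume s: "s \<in> {val x | x. n \<le> len x} - {val x | x. Suc n \<le> len x}"
    then obtain x where x: "s = val x" "n \<le> len x" by blast
    obtain y where y: "y \<in> normal_monomials" "val y = val x" "len x \<le> len y"
      using normal_form_exists by blast
    have "\<not> Suc n \<le> len y"
    proof
      assume "Suc n \<le> len y"
      then have "val y \<in> {val x | x. Suc n \<le> len x}" by blast
      then show False using s x(1) y(2) by simp
    qed
    then have "len y = n" using x(2) y(3) by simp
    then show "s \<in> val ` {x \<in> normal_monomials. len x = n}" using x(1) y(1,2) by (intro image_eqI[of _ _ y]) simp_all
  next
    fix s assume "s \<in> val ` {x \<in> normal_monomials. len x = n}"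
    then obtain x where x: "s = val x" "x \<in> normal_monomials" "len x = n" by blast
    have "\<not> Suc n \<le> len z" if "s = val z" for z
    proof -
      have "len z \<le> len x" using x(2) by (rule len_le_normal) (simp only: x(1) flip: that)
      then show ?thesis using x(3) by simp
    qed
    then have "s \<notin> {val x | x. Suc n \<le> len x}" by blast
    moreover have "s \<in> {val x | x. n \<le> len x}" using x(1,3) by blast
    ultimately show "s \<in> {val x | x. n \<le> len x} - {val x | x. Suc n \<le> len x}" by blast
  qed
  moreover have "inj_on val {x \<in> normal_monomials. len x = n}"
    by (rule inj_onI, rule normal_form_unique) simp_all
  ultimately show ?thesis by (simp add: card_image)
qed

end

section \<open>Monotonicity of the Hilbert function\<close>

lemma sums_of_length_four:
  assumes "distinct [n1, n2, n3, n4]"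
  shows "sums_of_length {n1, n2, n3, n4} n =
    {a * n1 + b * n2 + c * n3 + d * n4 | a b c d. n \<le> a + b + c + d}"
proof (intro equalityI subsetI)
  fix s assume "s \<in> sums_of_length {n1, n2, n3, n4} n"
  then obtain u where "s = (\<Sum>g\<in>{n1, n2, n3, n4}. u g * g)" "n \<le> (\<Sum>g\<in>{n1, n2, n3, n4}. u g)"
    by (auto simp: sums_of_length_def)
  then have "s = u n1 * n1 + u n2 * n2 + u n3 * n3 + u n4 * n4" "n \<le> u n1 + u n2 + u n3 + u n4"
    using assms by (simp_all add: add.assoc)
  then show "s \<in> {a * n1 + b * n2 + c * n3 + d * n4 | a b c d. n \<le> a + b + c + d}" by blast
next
  fix s assume "s \<in> {a * n1 + b * n2 + c * n3 + d * n4 | a b c d. n \<le> a + b + c + d}"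
  then obtain a b c d where s: "s = a * n1 + b * n2 + c * n3 + d * n4" "n \<le> a + b + c + d" by blast
  let ?u = "\<lambda>g. if g = n1 then a else if g = n2 then b else if g = n3 then c else d"
  have "s = (\<Sum>g\<in>{n1, n2, n3, n4}. ?u g * g)" "n \<le> (\<Sum>g\<in>{n1, n2, n3, n4}. ?u g)"
    using assms s by auto
  then show "s \<in> sums_of_length {n1, n2, n3, n4} n"
    unfolding sums_of_length_def by (intro CollectI exI[of _ ?u] conjI)
qed

lemma (in pseudo_symmetric_relations) hilbert_function_mono:
  "hilbert_function (monomial_fps_ring {n1, n2, n3, n4} :: 'k::field fps ring) (monomial_ideal {n1, n2, n3, n4}) n
    \<le> hilbert_function (monomial_fps_ring {n1, n2, n3, n4} :: 'k fps ring) (monomial_ideal {n1, n2, n3, n4}) (Suc n)"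
proof -
  have sums: "sums_of_length {n1, n2, n3, n4} k = {val x | x. k \<le> len x}" for k
  proof -
    have "distinct [n1, n2, n3, n4]" using less by auto
    then show ?thesis by (subst sums_of_length_four) fastforce+
  qed
  have "finite {n1, n2, n3, n4}" "0 \<notin> {n1, n2, n3, n4}" using pos less by auto
  note hilbert = hilbert_function_monomial_fps_ring[OF this, where 'k = 'k]
  show ?thesis
    unfolding hilbert sums card_val_len by (rule card_normal_len_mono)
qed

theorem theorem4p5:
  fixes n1 n2 n3 n4 :: nat
    and \<alpha>1 \<alpha>2 \<alpha>3 \<alpha>4 \<alpha>21 :: int
    and R :: "'k::alg_closed_field fps ring"
    and M :: "'k fps set"
  assumes "0 < n1" and "n1 < n2" and "n2 < n3" and "n3 < n4"
    and "Gcd {n1, n2, n3, n4} = 1"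
    and "minimal_generators {n1, n2, n3, n4}"
    and "pseudo_symmetric (gen_semigroup {n1, n2, n3, n4})"
    and "\<alpha>1 > 1" and "\<alpha>2 > 1" and "\<alpha>3 > 1" and "\<alpha>4 > 1"
    and "0 < \<alpha>21" and "\<alpha>21 < \<alpha>1 - 1"
    and "int n1 = \<alpha>2 * \<alpha>3 * (\<alpha>4 - 1) + 1"
    and "int n2 = \<alpha>21 * \<alpha>3 * \<alpha>4 + (\<alpha>1 - \<alpha>21 - 1) * (\<alpha>3 - 1) + \<alpha>3"
    and "int n3 = \<alpha>1 * \<alpha>4 + (\<alpha>1 - \<alpha>21 - 1) * (\<alpha>2 - 1) * (\<alpha>4 - 1) - \<alpha>4 + 1"
    and "int n4 = \<alpha>1 * \<alpha>2 * (\<alpha>3 - 1) + \<alpha>21 * (\<alpha>2 - 1) + \<alpha>2"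
    and "\<alpha>2 > \<alpha>21 + 1"
    and "R = monomial_fps_ring {n1, n2, n3, n4}"
    and "M = monomial_ideal {n1, n2, n3, n4}"
  shows "\<forall>n\<ge>1. hilbert_function R M n \<ge> hilbert_function R M (n - 1)"
proof -
  define p \<delta> g h m where
    "p = nat \<alpha>21" and "\<delta> = nat (\<alpha>2 - \<alpha>21 - 1)" and "g = nat (\<alpha>1 - \<alpha>21 - 1)"
    and "h = nat (\<alpha>3 - 1)" and "m = nat (\<alpha>4 - 1)"
  have params: "0 < p" "0 < \<delta>" "0 < g" "0 < h" "0 < m"
    using assms by (simp_all add: p_def \<delta>_def g_def h_def m_def)
  have \<alpha>: "\<alpha>21 = int p" "\<alpha>2 = int p + 1 + int \<delta>" "\<alpha>1 = int p + 1 + int g" "\<alpha>3 = int h + 1" "\<alpha>4 = int m + 1"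
    using assms by (simp_all add: p_def \<delta>_def g_def h_def m_def)
  have n: "n1 = (p + 1 + \<delta>) * (h + 1) * m + 1"
    "n2 = p * (h + 1) * (m + 1) + g * h + (h + 1)"
    "n3 + m = (p + 1 + g) * (m + 1) + g * (p + \<delta>) * m"
    "n4 = (p + 1 + g) * (p + 1 + \<delta>) * h + p * (p + \<delta>) + (p + 1 + \<delta>)"
  proof -
    have "int n1 = int ((p + 1 + \<delta>) * (h + 1) * m + 1)"
      "int n2 = int (p * (h + 1) * (m + 1) + g * h + (h + 1))"
      "int (n3 + m) = int ((p + 1 + g) * (m + 1) + g * (p + \<delta>) * m)"
      "int n4 = int ((p + 1 + g) * (p + 1 + \<delta>) * h + p * (p + \<delta>) + (p + 1 + \<delta>))"
      using assms(14-17) by (simp_all add: \<alpha> algebra_simps)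
    then show "n1 = (p + 1 + \<delta>) * (h + 1) * m + 1"
      "n2 = p * (h + 1) * (m + 1) + g * h + (h + 1)"
      "n3 + m = (p + 1 + g) * (m + 1) + g * (p + \<delta>) * m"
      "n4 = (p + 1 + g) * (p + 1 + \<delta>) * h + p * (p + \<delta>) + (p + 1 + \<delta>)"
      by (simp_all only: of_nat_eq_iff)
  qed
  have n3: "n3 = p * m + p + 1 + g * m + g + g * (p + \<delta>) * m"
    using n(3) by (simp add: algebra_simps)
  interpret pseudo_symmetric_relations n1 n2 n3 n4 p \<delta> g h m
  proof
    show "gcd n1 (gcd n2 (gcd n3 n4)) = 1" using assms(5) by simp
    show "(p + 1 + g) * n1 = n3 + m * n4" "(p + 1 + \<delta>) * n2 = p * n1 + n4"
      "(h + 1) * n3 = g * n1 + n2" "(m + 1) * n4 = n1 + (p + \<delta>) * n2 + h * n3"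
      "(p + 1) * n1 + h * n3 = n2 + m * n4"
      unfolding n3 n(1) n(2) n(4) by (simp_all add: algebra_simps)
  qed (use assms params n(1) in simp_all)
  show ?thesis
  proof (intro allI impI)
    fix n :: nat assume "1 \<le> n"
    then have "Suc (n - 1) = n" by simp
    then show "hilbert_function R M n \<ge> hilbert_function R M (n - 1)"
      using hilbert_function_mono[of "n - 1"] unfolding assms(19,20) by metis
  qed
qed

end
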